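(* Let $\mu(x),\nu(x)$ be probability densities on $\mathbb T^d$ with positive constants $m_\mu,M_\mu,m_\nu,M_\nu$ such that $\mu(x)\in[m_\mu,M_\mu]$ and $\nu(x)\in[m_\nu,M_\nu]$ for all $x\in\mathbb T^d$. Let $\varepsilon>0$ and let $(\phi_\varepsilon,\psi_\varepsilon)$ be the Schrödinger potentials for $\mathrm{EOT}_\varepsilon(\mu,\nu)$. Let $\alpha,R>0$ be the constants such that $x\mapsto\mathrm{dist}(0_d,x)^2$ is $\alpha$-strongly convex on $B_{\mathbb T^d}(0_d,R)$ (see context). Then there exist positive constants $C_\nu$ depending only on $m_\nu,M_\nu,d$ and $C_\mu$ depending only on $m_\mu,M_\mu,d$ such that for all $\chi,\eta\in\mathcal C(\mathbb T^d)$, $$\mathbb V_\mu(\chi)\le\Big(4\varepsilon+C_\nu e^{\frac{2R^2}{\alpha}+8\pi^2d}+\frac{8\,\mathrm{osc}(\chi)^2}{3\varepsilon}\Big)\big[\mathcal I^\varepsilon_{\mu,\nu}[\phi_\varepsilon]-\mathcal I^\varepsilon_{\mu,\nu}[\phi_\varepsilon+\chi]\big],$$ $$\mathbb V_\nu(\eta)\le\Big(4\varepsilon+C_\mu e^{\frac{2R^2}{\alpha}+8\pi^2d}+\frac{8\,\mathrm{osc}(\eta)^2}{3\varepsilon}\Big)\big[\overline{\mathcal I}^\varepsilon_{\mu,\nu}[\psi_\varepsilon]-\overline{\mathcal I}^\varepsilon_{\mu,\nu}[\psi_\varepsilon+\eta]\big].$$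
   Context: $\mathbb T^d=\mathbb R^d/2\pi\mathbb Z^d$ with $\mathrm{dist}(x,y)=\min_{k\in\mathbb Z^d}\|x-y-2\pi k\|$ and $B_{\mathbb T^d}(x,r)$ the open ball. For a geodesically convex $S\subset\mathbb T^d$, $f$ is $\alpha$-strongly convex on $S$ if $f(z)\le(1-\lambda)f(x_0)+\lambda f(x_1)-\frac{\alpha\lambda(1-\lambda)}2\mathrm{dist}(x_0,x_1)^2$ for all $\lambda\in[0,1]$, $x_0,x_1\in S$ and $z\in S$ with $\mathrm{dist}(z,x_0)=\lambda\,\mathrm{dist}(x_0,x_1)$, $\mathrm{dist}(z,x_1)=(1-\lambda)\mathrm{dist}(x_0,x_1)$; $\alpha,R>0$ are fixed constants for which $x\mapsto\mathrm{dist}(0_d,x)^2$ is $\alpha$-strongly convex on $B_{\mathbb T^d}(0_d,R)$. $\mathcal K_\varepsilon(x)=(2\pi\varepsilon)^{-d/2}\sum_{k}e^{-\|x-2\pi k\|^2/(2\varepsilon)}$, $c_\varepsilon(x,y)=-\varepsilon\log\mathcal K_\varepsilon(x-y)$. $\mathcal T^\varepsilon_\mu[\phi](y)=-\varepsilon\log\int e^{(\phi(x)-c_\varepsilon(x,y))/\varepsilon}d\mu(x)$, $\mathcal T^\varepsilon_\nu[\psi](x)=-\varepsilon\log\int e^{(\psi(y)-c_\varepsilon(x,y))/\varepsilon}d\nu(y)$. $\mathcal I^\varepsilon_{\mu,\nu}[\phi]=\int\phi\,d\mu+\int\mathcal T^\varepsilon_\mu[\phi]\,d\nu$ and $\overline{\mathcal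 I}^\varepsilon_{\mu,\nu}[\psi]=\int\mathcal T^\varepsilon_\nu[\psi]\,d\mu+\int\psi\,d\nu$. $\mathrm{EOT}_\varepsilon(\mu,\nu)=\min_{\pi\in\Pi(\mu,\nu)}\int c_\varepsilon d\pi+\varepsilon\mathrm{KL}(\pi\|\mu\otimes\nu)$, and the Schrödinger potentials satisfy $\phi_\varepsilon\in\arg\max\mathcal I^\varepsilon_{\mu,\nu}$, $\psi_\varepsilon\in\arg\max\overline{\mathcal I}^\varepsilon_{\mu,\nu}$, with $\phi_\varepsilon=\mathcal T^\varepsilon_\nu[\psi_\varepsilon]$, $\psi_\varepsilon=\mathcal T^\varepsilon_\mu[\phi_\varepsilon]$. $\mathbb V_\mu(f)=\int(f-\int f\,d\mu)^2d\mu$; $\mathrm{osc}(f)=\sup f-\inf f$. *)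

theory Defs
  imports "HOL-Analysis.Analysis"
begin

text \<open>The torus T^d = R^d / 2 pi Z^d is modelled by 2 pi-periodic functions on real^'d;
  d = CARD('d). Integration over T^d is Lebesgue integration over the fundamental cube
  [0, 2 pi]^d. Densities are with respect to Lebesgue measure on T^d.\<close>

definition lattice :: "(real^'d) set" where
  "lattice = {k. \<forall>i. k $ i \<in> \<int>}"

definition tper :: "(real^'d \<Rightarrow> 'b) \<Rightarrow> bool" where
  "tper f \<longleftrightarrow> (\<forall>x k. k \<in> lattice \<longrightarrow> f (x + (2*pi) *\<^sub>R k) = f x)"

definition tdist :: "real^'d \<Rightarrow> real^'d \<Rightarrow> real" where
  "tdist x y = (INF k\<in>lattice. norm (x - y - (2*pi) *\<^sub>R k))"

definition tball :: "real^'d \<Rightarrow> real \<Rightarrow> (real^'d) set" where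
  "tball x r = {y. tdist x y < r}"

definition strongly_convex_T :: "real \<Rightarrow> (real^'d) set \<Rightarrow> (real^'d \<Rightarrow> real) \<Rightarrow> bool" where
  "strongly_convex_T a S f \<longleftrightarrow>
     (\<forall>l x0 x1 z. 0 \<le> l \<and> l \<le> 1 \<and> x0 \<in> S \<and> x1 \<in> S \<and> z \<in> S \<and>
        tdist z x0 = l * tdist x0 x1 \<and> tdist z x1 = (1 - l) * tdist x0 x1 \<longrightarrow>
        f z \<le> (1 - l) * f x0 + l * f x1 - a * l * (1 - l) / 2 * (tdist x0 x1)\<^sup>2)"

definition cube :: "(real^'d) set" where
  "cube = cbox 0 (\<chi> i. 2 * pi)"

definition tint :: "(real^'d \<Rightarrow> real) \<Rightarrow> real" where
  "tint f = (LINT x:cube|lborel. f x)"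

definition heat_kernel :: "real \<Rightarrow> real^'d \<Rightarrow> real" where
  "heat_kernel eps x = (2 * pi * eps) powr (- real CARD('d) / 2) *
     (\<Sum>\<^sub>\<infinity>k\<in>lattice. exp (- (norm (x - (2*pi) *\<^sub>R k))\<^sup>2 / (2 * eps)))"

definition ecost :: "real \<Rightarrow> real^'d \<Rightarrow> real^'d \<Rightarrow> real" where
  "ecost eps x y = - eps * ln (heat_kernel eps (x - y))"

definition cT_mu :: "real \<Rightarrow> (real^'d \<Rightarrow> real) \<Rightarrow> (real^'d \<Rightarrow> real) \<Rightarrow> real^'d \<Rightarrow> real" where
  "cT_mu eps mu phi y = - eps * ln (tint (\<lambda>x. exp ((phi x - ecost eps x y) / eps) * mu x))"

definition cT_nu :: "real \<Rightarrow> (real^'d \<Rightarrow> real) \<Rightarrow> (real^'d \<Rightarrow> real) \<Rightarrow> real^'d \<Rightarrow> real" where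
  "cT_nu eps nu psi x = - eps * ln (tint (\<lambda>y. exp ((psi y - ecost eps x y) / eps) * nu y))"

definition Idual :: "real \<Rightarrow> (real^'d \<Rightarrow> real) \<Rightarrow> (real^'d \<Rightarrow> real) \<Rightarrow> (real^'d \<Rightarrow> real) \<Rightarrow> real" where
  "Idual eps mu nu phi = tint (\<lambda>x. phi x * mu x) + tint (\<lambda>y. cT_mu eps mu phi y * nu y)"

definition Idualbar :: "real \<Rightarrow> (real^'d \<Rightarrow> real) \<Rightarrow> (real^'d \<Rightarrow> real) \<Rightarrow> (real^'d \<Rightarrow> real) \<Rightarrow> real" where
  "Idualbar eps mu nu psi = tint (\<lambda>x. cT_nu eps nu psi x * mu x) + tint (\<lambda>y. psi y * nu y)"

definition tvar :: "(real^'d \<Rightarrow> real) \<Rightarrow> (real^'d \<Rightarrow> real) \<Rightarrow> real" where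
  "tvar mu f = tint (\<lambda>x. (f x - tint (\<lambda>y. f y * mu y))\<^sup>2 * mu x)"

definition osc :: "(real^'d \<Rightarrow> real) \<Rightarrow> real" where
  "osc f = (SUP x. f x) - (INF x. f x)"

definition tcont :: "(real^'d \<Rightarrow> real) \<Rightarrow> bool" where
  "tcont f \<longleftrightarrow> continuous_on UNIV f \<and> tper f"

definition bounded_density :: "(real^'d \<Rightarrow> real) \<Rightarrow> real \<Rightarrow> real \<Rightarrow> bool" where
  "bounded_density mu m M \<longleftrightarrow> mu \<in> borel_measurable borel \<and> tper mu \<and>
     (\<forall>x. m \<le> mu x \<and> mu x \<le> M) \<and> tint mu = 1"

definition schrodinger_potentials ::
  "real \<Rightarrow> (real^'d \<Rightarrow> real) \<Rightarrow> (real^'d \<Rightarrow> real) \<Rightarrow> (real^'d \<Rightarrow> real) \<Rightarrow> (real^'d \<Rightarrow> real) \<Rightarrow> bool" where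
  "schrodinger_potentials eps mu nu phi psi \<longleftrightarrow>
     tcont phi \<and> tcont psi \<and> phi = cT_nu eps nu psi \<and> psi = cT_mu eps mu phi \<and>
     (\<forall>f. tcont f \<longrightarrow> Idual eps mu nu f \<le> Idual eps mu nu phi) \<and>
     (\<forall>g. tcont g \<longrightarrow> Idualbar eps mu nu g \<le> Idualbar eps mu nu psi)"

end

theory Submission
  imports Defs
begin

text \<open>
  Write \<open>X = (\<chi> - inf \<chi>) / \<epsilon>\<close> and let \<open>\<pi>\<^sub>t\<^sup>y\<close> be the conditional law of \<open>x\<close> given \<open>y\<close> under the
  Schroedinger plan, tilted by \<open>exp (t X)\<close>. Let \<open>\<Lambda>(y, t)\<close> be the logarithm of its normalizing constant,
  whose \<open>t\<close>-derivatives are the mean \<open>P(y, t)\<close> and the variance of \<open>X\<close> under \<open>\<pi>\<^sub>t\<^sup>y\<close>.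
  The dual gap is \<open>\<epsilon> D(1)\<close>, where \<open>D(t)\<close> is the \<open>\<nu>\<close>-average of \<open>\<Lambda>(y, t) - t P(y, 0)\<close>.

  The potential \<open>\<psi>\<^sub>t(y) = T\<^sub>\<mu>[\<phi> + t \<chi>](y)\<close> minus \<open>|y|\<^sup>2 / 2\<close> is jointly concave in \<open>(t, y)\<close>, so by the
  Prekopa--Leindler inequality the integral of \<open>exp (\<psi>\<^sub>t(y) - |y|\<^sup>2 / 2)\<close> over the fundamental cube is
  log-concave in \<open>t\<close>. Its second derivative is a Brascamp--Lieb inequality bounding the variance of \<open>P(y, t)\<close>
  in \<open>y\<close> by \<open>1/\<epsilon>\<close> times the mean conditional variance. As \<open>\<psi>\<^sub>t\<close> is periodic and semiconcave, its oscillation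
  is bounded in terms of \<open>d\<close> only, and the inequality transfers to \<open>\<nu>\<close> with a constant independent of \<open>\<epsilon>\<close>.
  Since second moments of \<open>X \<ge> 0\<close> increase along the tilt, the variance of \<open>X\<close> under \<open>\<mu>\<close> is at most
  \<open>(1 + C/\<epsilon>) D''(t) + 2 sup X D'(t)\<close>, and integrating this in \<open>t\<close> gives the claim.
\<close>

section \<open>The Prekopa--Leindler inequality\<close>

lemma emeasure_lborel_translate:
  fixes A :: "real set"
  assumes "A \<in> sets borel"
  shows "(\<lambda>x. x + c) ` A \<in> sets borel" "emeasure lborel ((\<lambda>x. x + c) ` A) = emeasure lborel A"
proof -
  have eq: "(\<lambda>x. x + c) ` A = (\<lambda>x. - c + x) -` A"
    by (auto simp: image_iff) (metis add.commute add_diff_cancel_left' diff_minus_eq_add minus_diff_eq)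
  show "(\<lambda>x. x + c) ` A \<in> sets borel"
    unfolding eq by (rule measurable_sets_borel[OF _ assms]) simp
  have "emeasure lborel A = emeasure (distr lborel borel ((+) (- c))) A"
    by (simp add: lborel_distr_plus)
  also have "\<dots> = emeasure lborel ((\<lambda>x. - c + x) -` A)"
    using assms by (subst emeasure_distr) auto
  finally show "emeasure lborel ((\<lambda>x. x + c) ` A) = emeasure lborel A"
    by (simp add: eq)
qed

text \<open>Translate \<open>A\<close> by a point of \<open>B\<close> near \<open>Inf B\<close>, and
  \<open>B\<close> by a point of \<open>A\<close> near \<open>Sup A\<close>. Both translates lie in
  \<open>C\<close>, and they overlap at most in an interval of length \<open>e\<close> around
  \<open>Sup A + Inf B\<close>. The superset \<open>C\<close> stands in for the sum set, which need
  not be Borel.\<close>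

lemma brunn_minkowski_real_bounded:
  fixes A B C :: "real set"
  assumes A: "A \<in> sets borel" "A \<noteq> {}" "bdd_above A"
    and B: "B \<in> sets borel" "B \<noteq> {}" "bdd_below B"
    and C: "C \<in> sets borel" "\<And>x y. x \<in> A \<Longrightarrow> y \<in> B \<Longrightarrow> x + y \<in> C"
  shows "emeasure lborel A + emeasure lborel B \<le> emeasure lborel C"
proof (rule ennreal_le_epsilon)
  fix e :: real assume e: "0 < e"
  obtain a where a: "a \<in> A" "Sup A - e/2 < a"
    using less_cSupD[OF A(2), of "Sup A - e/2"] e by auto
  obtain b where b: "b \<in> B" "b < Inf B + e/2"
    using cInf_lessD[OF B(2), of "Inf B + e/2"] e by auto
  let ?A = "(\<lambda>x. x + b) ` A" and ?B = "(\<lambda>x. x + a) ` B"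
  note tA = emeasure_lborel_translate[OF A(1), of b] and tB = emeasure_lborel_translate[OF B(1), of a]
  have "?A \<inter> ?B \<subseteq> {Sup A + Inf B - e/2 .. Sup A + Inf B + e/2}"
  proof
    fix z assume "z \<in> ?A \<inter> ?B"
    then obtain x y where "x \<in> A" "y \<in> B" "z = x + b" "z = y + a" by auto
    moreover have "x \<le> Sup A" "Inf B \<le> y"
      using cSup_upper[OF \<open>x \<in> A\<close> A(3)] cInf_lower[OF \<open>y \<in> B\<close> B(3)] by auto
    ultimately show "z \<in> {Sup A + Inf B - e/2 .. Sup A + Inf B + e/2}"
      using a b by auto
  qed
  then have "emeasure lborel (?A \<inter> ?B) \<le> emeasure lborel {Sup A + Inf B - e/2 .. Sup A + Inf B + e/2}"
    by (intro emeasure_mono) auto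
  also have "\<dots> = ennreal e" using e by simp
  finally have int: "emeasure lborel (?A \<inter> ?B) \<le> ennreal e" .
  have "?A \<union> ?B \<subseteq> C"
    using C(2) a(1) b(1) by (auto simp: add.commute[of _ a])
  then have un: "emeasure lborel (?A \<union> ?B) \<le> emeasure lborel C"
    using C(1) by (intro emeasure_mono) auto
  have "emeasure lborel A + emeasure lborel B = emeasure lborel ?A + emeasure lborel ?B"
    by (simp add: tA tB)
  also have "\<dots> = emeasure lborel (?A \<union> ?B) + emeasure lborel (?A \<inter> ?B)"
    using tA(1) tB(1) by (intro emeasure_Un_Int) auto
  also have "\<dots> \<le> emeasure lborel C + ennreal e"
    by (rule add_mono[OF un int])
  finally show "emeasure lborel A + emeasure lborel B \<le> emeasure lborel C + ennreal e" .
qed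

text \<open>The bounded case asks for an upper bound on \<open>A\<close> and a lower bound on
  \<open>B\<close> only, so one-sided truncations suffice; continuity from below removes
  them.\<close>

lemma brunn_minkowski_real:
  fixes A B C :: "real set"
  assumes A: "A \<in> sets borel" "A \<noteq> {}"
    and B: "B \<in> sets borel" "B \<noteq> {}"
    and C: "C \<in> sets borel" "\<And>x y. x \<in> A \<Longrightarrow> y \<in> B \<Longrightarrow> x + y \<in> C"
  shows "emeasure lborel A + emeasure lborel B \<le> emeasure lborel C"
proof -
  obtain a b where a: "a \<in> A" and b: "b \<in> B" using A B by auto
  \<comment> \<open>The offsets by the absolute values of \<open>a\<close> and \<open>b\<close> keep
    every truncation nonempty, already for \<open>n = 0\<close>.\<close>
  define A' where "A' n = A \<inter> {.. \<bar>a\<bar> + real n}" for n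
  define B' where "B' n = B \<inter> {- \<bar>b\<bar> - real n ..}" for n
  have mono: "incseq A'" "incseq B'"
    by (auto simp: incseq_def A'_def B'_def)
  have UA: "(\<Union>n. A' n) = A"
  proof (intro equalityI subsetI)
    fix x assume x: "x \<in> A"
    obtain n where "x \<le> real n" using real_arch_simple by blast
    with x show "x \<in> (\<Union>n. A' n)" by (auto simp: A'_def intro!: exI[of _ n])
  qed (auto simp: A'_def)
  have UB: "(\<Union>n. B' n) = B"
  proof (intro equalityI subsetI)
    fix x assume x: "x \<in> B"
    obtain n where "- x \<le> real n" using real_arch_simple by blast
    with x show "x \<in> (\<Union>n. B' n)" by (auto simp: B'_def intro!: exI[of _ n])
  qed (auto simp: B'_def)
  have [measurable]: "A' n \<in> sets borel" "B' n \<in> sets borel" for n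
    using A B by (auto simp: A'_def B'_def)
  have "(\<lambda>n. emeasure lborel (A' n) + emeasure lborel (B' n)) \<longlonglongrightarrow> emeasure lborel A + emeasure lborel B"
    using Lim_emeasure_incseq[of A' lborel, OF _ mono(1)] Lim_emeasure_incseq[of B' lborel, OF _ mono(2)]
    by (intro tendsto_add) (auto simp: UA UB image_subset_iff)
  moreover have "emeasure lborel (A' n) + emeasure lborel (B' n) \<le> emeasure lborel C" for n
  proof (rule brunn_minkowski_real_bounded[OF _ _ _ _ _ _ C(1)])
    show "A' n \<noteq> {}" "B' n \<noteq> {}"
      using a b by (auto simp: A'_def B'_def intro!: exI[of _ a] exI[of _ b])
    show "bdd_above (A' n)" "bdd_below (B' n)"
      by (auto simp: A'_def B'_def)
    show "x + y \<in> C" if "x \<in> A' n" "y \<in> B' n" for x y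
      using that C(2) by (auto simp: A'_def B'_def)
  qed auto
  ultimately show ?thesis
    by (intro LIMSEQ_le_const2) auto
qed

text \<open>\<open>C'\<close> is \<open>C\<close> dilated by 2: it contains the sum set, and the
  dilation doubles Lebesgue measure.\<close>

lemma brunn_minkowski_midpoint:
  fixes A B C :: "real set"
  assumes A: "A \<in> sets borel" "A \<noteq> {}"
    and B: "B \<in> sets borel" "B \<noteq> {}"
    and C: "C \<in> sets borel" "\<And>x y. x \<in> A \<Longrightarrow> y \<in> B \<Longrightarrow> (x + y) / 2 \<in> C"
  shows "emeasure lborel A + emeasure lborel B \<le> 2 * emeasure lborel C"
proof -
  define C' where "C' = (\<lambda>x. x / 2) -` C"
  have C': "C' \<in> sets borel" unfolding C'_def using measurable_sets_borel[OF _ C(1), of "\<lambda>x. x / 2"] by simp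
  have "emeasure lborel A + emeasure lborel B \<le> emeasure lborel C'"
    using C by (intro brunn_minkowski_real A B C') (auto simp: C'_def)
  also have "emeasure lborel C' = 2 * emeasure lborel C"
  proof -
    have "emeasure lborel C = emeasure (density (distr lborel borel (\<lambda>x. 0 + (1/2) * x)) (\<lambda>_. ennreal \<bar>1/2\<bar>)) C"
      using lborel_real_affine[of "1/2" 0] by simp
    also have "\<dots> = ennreal (1/2) * emeasure (distr lborel borel (\<lambda>x. 0 + (1/2) * x)) C"
      using C(1) by (subst emeasure_density) (auto simp: nn_integral_cmult_indicator)
    also have "emeasure (distr lborel borel (\<lambda>x. 0 + (1/2) * x)) C = emeasure lborel C'"
      using C(1) by (subst emeasure_distr) (auto simp: C'_def)
    finally have "2 * emeasure lborel C = 2 * (ennreal (1/2) * emeasure lborel C')" by simp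
    also have "\<dots> = (ennreal 2 * ennreal (1/2)) * emeasure lborel C'"
      by (simp add: mult.assoc)
    also have "ennreal 2 * ennreal (1/2) = 1"
      by (subst ennreal_mult[symmetric]) auto
    finally show ?thesis by simp
  qed
  finally show ?thesis .
qed

section \<open>Layer-cake formula and Prekopa--Leindler on the line\<close>

lemma emeasure_lborel_below: "emeasure lborel {t::real. 0 \<le> t \<and> ennreal t < u} = u"
proof (cases u)
  case (real r)
  then have "{t. 0 \<le> t \<and> ennreal t < u} = {0..<r}"
    by (auto simp: ennreal_less_iff)
  with real show ?thesis by simp
next
  case top
  then have "{t. 0 \<le> t \<and> ennreal t < u} = {0..}" by (auto simp: ennreal_less_top)
  moreover have "emeasure lborel {0::real..} = \<infinity>"
  proof (rule ccontr)
    assume *: "emeasure lborel {0::real..} \<noteq> \<infinity>"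
    have "ennreal (real n) \<le> emeasure lborel {0::real..}" for n :: nat
      using emeasure_mono[of "{0..real n}" "{0..}" lborel] by simp
    then have "ennreal r \<le> emeasure lborel {0::real..}" for r
      by (meson ennreal_leI order_trans real_arch_simple)
    from this[of "enn2real (emeasure lborel {0::real..}) + 1"] * show False
      by (cases "emeasure lborel {0::real..}") (auto simp: top_ennreal_def[symmetric])
  qed
  ultimately show ?thesis using top by simp
qed

text \<open>Tonelli's theorem for the indicator of the region under the graph of \<open>f\<close>:
  sliced at fixed \<open>x\<close> it has length \<open>f x\<close>, sliced at height
  \<open>t\<close> it is a superlevel set.\<close>

lemma nn_integral_layer_cake:
  fixes f :: "real \<Rightarrow> ennreal"
  assumes [measurable]: "f \<in> borel_measurable borel"
  shows "(\<integral>\<^sup>+x. f x \<partial>lborel) = (\<integral>\<^sup>+t. indicator {0..} t * emeasure lborel {x. ennreal t < f x} \<partial>lborel)"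
proof -
  let ?g = "\<lambda>t x. indicator {0..} t * indicator {(t, x). ennreal t < f x} (t, x) :: ennreal"
  have "{p \<in> space (borel \<Otimes>\<^sub>M borel). ennreal (fst p) < f (snd p)} \<in> sets (borel \<Otimes>\<^sub>M borel)"
    by measurable
  then have [measurable]: "{(t, x). ennreal t < f x} \<in> sets (borel \<Otimes>\<^sub>M borel)"
    by (simp add: space_pair_measure case_prod_unfold)
  have "(\<integral>\<^sup>+x. f x \<partial>lborel) = (\<integral>\<^sup>+x. (\<integral>\<^sup>+t. ?g t x \<partial>lborel) \<partial>lborel)"
  proof (rule nn_integral_cong)
    fix x
    have "(\<integral>\<^sup>+t. ?g t x \<partial>lborel) = (\<integral>\<^sup>+t. indicator {t. 0 \<le> t \<and> ennreal t < f x} t \<partial>lborel)"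
      by (intro nn_integral_cong) (auto split: split_indicator)
    also have "\<dots> = f x"
      by (subst nn_integral_indicator) (auto simp: emeasure_lborel_below)
    finally show "f x = (\<integral>\<^sup>+t. ?g t x \<partial>lborel)" by simp
  qed
  also have "\<dots> = (\<integral>\<^sup>+t. (\<integral>\<^sup>+x. ?g t x \<partial>lborel) \<partial>lborel)"
    by (rule lborel_pair.Fubini') measurable
  also have "\<dots> = (\<integral>\<^sup>+t. indicator {0..} t * emeasure lborel {x. ennreal t < f x} \<partial>lborel)"
  proof (rule nn_integral_cong)
    fix t
    have "(\<integral>\<^sup>+x. ?g t x \<partial>lborel) = (\<integral>\<^sup>+x. indicator {0..} t * indicator {x. ennreal t < f x} x \<partial>lborel)"
      by (intro nn_integral_cong) (auto split: split_indicator)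
    also have "\<dots> = indicator {0..} t * emeasure lborel {x. ennreal t < f x}"
      by (rule nn_integral_cmult_indicator) measurable
    finally show "(\<integral>\<^sup>+x. ?g t x \<partial>lborel) = indicator {0..} t * emeasure lborel {x. ennreal t < f x}" .
  qed
  finally show ?thesis .
qed

text \<open>Midpoints of the superlevel sets of \<open>f\<close> and \<open>g\<close> at height
  \<open>t\<close> lie in that of \<open>h\<close>, so Brunn--Minkowski applies level by level. It
  needs nonempty sets; since both suprema equal 1, the sets of \<open>f\<close> and \<open>g\<close>
  are both nonempty for \<open>t < 1\<close> and both empty for \<open>t >= 1\<close>.\<close>

lemma prekopa_leindler_real_normalized:
  fixes f g h :: "real \<Rightarrow> ennreal"
  assumes [measurable]: "f \<in> borel_measurable borel" "g \<in> borel_measurable borel" "h \<in> borel_measurable borel"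
    and le: "\<And>x y. f x * g y \<le> (h ((x + y) / 2))\<^sup>2"
    and f: "(SUP x. f x) = 1" and g: "(SUP x. g x) = 1"
  shows "(\<integral>\<^sup>+x. f x \<partial>lborel) + (\<integral>\<^sup>+x. g x \<partial>lborel) \<le> 2 * (\<integral>\<^sup>+x. h x \<partial>lborel)"
proof -
  let ?S = "\<lambda>f t. {x. ennreal t < f x}"
  have "(\<integral>\<^sup>+x. f x \<partial>lborel) + (\<integral>\<^sup>+x. g x \<partial>lborel)
      = (\<integral>\<^sup>+t. indicator {0..} t * emeasure lborel (?S f t) + indicator {0..} t * emeasure lborel (?S g t) \<partial>lborel)"
    by (subst nn_integral_layer_cake, simp, subst nn_integral_layer_cake, simp)
       (rule nn_integral_add[symmetric]; measurable)
  also have "\<dots> \<le> (\<integral>\<^sup>+t. 2 * (indicator {0..} t * emeasure lborel (?S h t)) \<partial>lborel)"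
  proof (rule nn_integral_mono)
    fix t :: real
    consider "t < 0" | "0 \<le> t" "t < 1" | "1 \<le> t" by linarith
    then show "indicator {0..} t * emeasure lborel (?S f t) + indicator {0..} t * emeasure lborel (?S g t)
      \<le> 2 * (indicator {0..} t * emeasure lborel (?S h t))"
    proof cases
      case 2
      have "ennreal t < 1" using 2 by (simp add: ennreal_less_one_iff)
      then have ne: "?S f t \<noteq> {}" "?S g t \<noteq> {}"
        using f g by (metis (mono_tags, lifting) less_SUP_iff UNIV_I empty_iff mem_Collect_eq)+
      have "(x + y) / 2 \<in> ?S h t" if "x \<in> ?S f t" "y \<in> ?S g t" for x y
      proof -
        \<comment> \<open>Strictness comes from the factor \<open>f x\<close> alone: the chain is
          \<open>t * t <= t * g y < f x * g y\<close>, where \<open>g y\<close> is positive and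
          finite.\<close>
        have "(ennreal t)\<^sup>2 < f x * g y"
        proof -
          have "(ennreal t)\<^sup>2 \<le> ennreal t * g y"
            using that by (auto simp: power2_eq_square intro!: mult_left_mono)
          also have "\<dots> < f x * g y"
          proof (rule ennreal_mult_strict_right_mono)
            show "0 < g y" using that by (auto intro: le_less_trans[of 0 "ennreal t"])
            have "g y \<le> 1" using g by (metis SUP_upper UNIV_I)
            then show "g y < top" by (rule le_less_trans) simp
          qed (use that in auto)
          finally show ?thesis .
        qed
        then have "(ennreal t)\<^sup>2 < (h ((x + y) / 2))\<^sup>2" using le order_less_le_trans by blast
        then show ?thesis
          by (metis mem_Collect_eq not_le power_mono zero_le)
      qed
      then have "emeasure lborel (?S f t) + emeasure lborel (?S g t) \<le> 2 * emeasure lborel (?S h t)"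
        by (intro brunn_minkowski_midpoint ne) auto
      then show ?thesis using 2 by simp
    next
      case 3
      have "f x \<le> 1" "g x \<le> 1" for x
        using f g by (metis SUP_upper UNIV_I)+
      then have "?S f t = {}" "?S g t = {}"
        using 3 by (auto simp: not_less) (metis ennreal_leI ennreal_1 order_trans not_less)+
      then show ?thesis by simp
    qed simp
  qed
  also have "\<dots> = 2 * (\<integral>\<^sup>+x. h x \<partial>lborel)"
    by (subst nn_integral_cmult) (auto simp: nn_integral_layer_cake[symmetric])
  finally show ?thesis .
qed


lemma ennreal_AM_GM:
  fixes u v w :: ennreal
  assumes "u + v \<le> 2 * w"
  shows "u * v \<le> w\<^sup>2"
proof (cases "w = top")
  case False
  then have "2 * w < top" by (simp add: ennreal_mult_less_top less_top)
  then have "u + v < top" using assms by (rule le_less_trans[rotated])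
  then have "u < top" "v < top" by auto
  with False obtain u' v' w' where eq: "u = ennreal u'" "v = ennreal v'" "w = ennreal w'"
    and nn: "0 \<le> u'" "0 \<le> v'" "0 \<le> w'"
    by (metis ennreal_cases less_irrefl)
  have "ennreal (u' + v') \<le> ennreal (2 * w')"
    using assms nn by (simp add: eq ennreal_mult)
  then have "u' + v' \<le> 2 * w'" using nn by (subst (asm) ennreal_le_iff) auto
  then have "(u' + v')\<^sup>2 \<le> (2 * w')\<^sup>2"
    using nn by (intro power_mono) auto
  moreover have "0 \<le> (u' - v')\<^sup>2" by simp
  ultimately have "u' * v' \<le> w'\<^sup>2" by (simp add: power2_eq_square algebra_simps)
  then show ?thesis using nn by (simp add: eq ennreal_mult[symmetric] ennreal_power)
qed (simp add: power2_eq_square ennreal_top_mult)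

text \<open>The hypothesis is invariant under dividing \<open>f\<close>, \<open>g\<close>,
  \<open>h\<close> by \<open>a\<close>, \<open>b\<close>, \<open>sqrt (a * b)\<close>. With the
  suprema for \<open>a\<close> and \<open>b\<close> this reaches the normalized case, whose additive
  conclusion becomes multiplicative by AM-GM.\<close>

lemma prekopa_leindler_real_bounded:
  fixes f g h :: "real \<Rightarrow> ennreal"
  assumes [measurable]: "f \<in> borel_measurable borel" "g \<in> borel_measurable borel" "h \<in> borel_measurable borel"
    and le: "\<And>x y. f x * g y \<le> (h ((x + y) / 2))\<^sup>2"
    and f: "(SUP x. f x) < top" and g: "(SUP x. g x) < top"
  shows "(\<integral>\<^sup>+x. f x \<partial>lborel) * (\<integral>\<^sup>+x. g x \<partial>lborel) \<le> (\<integral>\<^sup>+x. h x \<partial>lborel)\<^sup>2"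
proof (cases "(SUP x. f x) = 0 \<or> (SUP x. g x) = 0")
  case True
  then have "(\<forall>x. f x = 0) \<or> (\<forall>x. g x = 0)" by (auto simp: SUP_eq_iff bot_ennreal[symmetric])
  then show ?thesis by auto
next
  case False
  obtain a where a: "0 \<le> a" "(SUP x. f x) = ennreal a" using f by (metis ennreal_cases less_irrefl)
  obtain b where b: "0 \<le> b" "(SUP x. g x) = ennreal b" using g by (metis ennreal_cases less_irrefl)
  have pos: "0 < a" "0 < b" using a b False by (auto simp: less_le)
  define c where "c = sqrt (a * b)"
  have c: "0 < c" "c\<^sup>2 = a * b" using pos by (auto simp: c_def)
  let ?f = "\<lambda>x. ennreal (1/a) * f x" and ?g = "\<lambda>x. ennreal (1/b) * g x" and ?h = "\<lambda>x. ennreal (1/c) * h x"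
  have "(\<integral>\<^sup>+x. ?f x \<partial>lborel) + (\<integral>\<^sup>+x. ?g x \<partial>lborel) \<le> 2 * (\<integral>\<^sup>+x. ?h x \<partial>lborel)"
  proof (rule prekopa_leindler_real_normalized)
    have "(SUP x. ?f x) = ennreal (1/a) * (SUP x. f x)" by (rule SUP_mult_left_ennreal[symmetric])
    then show "(SUP x. ?f x) = 1" using pos by (simp add: a ennreal_mult[symmetric])
    have "(SUP x. ?g x) = ennreal (1/b) * (SUP x. g x)" by (rule SUP_mult_left_ennreal[symmetric])
    then show "(SUP x. ?g x) = 1" using pos by (simp add: b ennreal_mult[symmetric])
    fix x y
    have "?f x * ?g y = ennreal (1/a * (1/b)) * (f x * g y)"
      using pos by (subst ennreal_mult) (auto simp: ac_simps)
    also have "1/a * (1/b) = (1/c)\<^sup>2" using c by (simp add: power_divide)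
    also have "ennreal ((1/c)\<^sup>2) * (f x * g y) \<le> ennreal ((1/c)\<^sup>2) * (h ((x + y) / 2))\<^sup>2"
      by (intro mult_left_mono le) auto
    also have "\<dots> = (?h ((x + y) / 2))\<^sup>2"
      using c by (simp add: power_mult_distrib ennreal_power)
    finally show "?f x * ?g y \<le> (?h ((x + y) / 2))\<^sup>2" .
  qed measurable
  from ennreal_AM_GM[OF this]
  have *: "(ennreal (1/a) * (\<integral>\<^sup>+x. f x \<partial>lborel)) * (ennreal (1/b) * (\<integral>\<^sup>+x. g x \<partial>lborel))
      \<le> (ennreal (1/c) * (\<integral>\<^sup>+x. h x \<partial>lborel))\<^sup>2"
    by (simp add: nn_integral_cmult)
  have s1: "ennreal (a * b) * ((ennreal (1/a) * u) * (ennreal (1/b) * v)) = u * v" for u v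
  proof -
    have "ennreal (a * b) * ((ennreal (1/a) * u) * (ennreal (1/b) * v))
        = ennreal (a * b) * (ennreal (1/a) * ennreal (1/b)) * (u * v)" by (simp add: ac_simps)
    also have "ennreal (a * b) * (ennreal (1/a) * ennreal (1/b)) = 1"
      using pos by (simp flip: ennreal_mult)
    finally show ?thesis by simp
  qed
  have s2: "ennreal (a * b) * (ennreal (1/c) * w)\<^sup>2 = w\<^sup>2" for w
  proof -
    have "ennreal (a * b) * (ennreal (1/c) * w)\<^sup>2 = ennreal (a * b) * ennreal ((1/c)\<^sup>2) * w\<^sup>2"
      using c by (simp add: power_mult_distrib ennreal_power mult.assoc)
    also have "ennreal (a * b) * ennreal ((1/c)\<^sup>2) = 1"
      using pos c by (simp add: power_divide flip: ennreal_mult)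
    finally show ?thesis by simp
  qed
  from mult_left_mono[OF *, of "ennreal (a * b)"] show ?thesis
    unfolding s1 s2 by simp
qed

text \<open>Cutting \<open>f\<close> and \<open>g\<close> off at height \<open>n\<close> only
  shrinks the left side of the hypothesis, so \<open>h\<close> can stay as it is; monotone
  convergence then restores \<open>f\<close> and \<open>g\<close>.\<close>

theorem prekopa_leindler_real:
  fixes f g h :: "real \<Rightarrow> ennreal"
  assumes [measurable]: "f \<in> borel_measurable borel" "g \<in> borel_measurable borel" "h \<in> borel_measurable borel"
    and le: "\<And>x y. f x * g y \<le> (h ((x + y) / 2))\<^sup>2"
  shows "(\<integral>\<^sup>+x. f x \<partial>lborel) * (\<integral>\<^sup>+x. g x \<partial>lborel) \<le> (\<integral>\<^sup>+x. h x \<partial>lborel)\<^sup>2"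
proof -
  have trunc: "(\<integral>\<^sup>+x. u x \<partial>lborel) = (SUP n. \<integral>\<^sup>+x. min (u x) (of_nat n) \<partial>lborel)"
    if [measurable]: "u \<in> borel_measurable borel" for u :: "real \<Rightarrow> ennreal"
  proof -
    have "(SUP n. min z (of_nat n)) = z" for z :: ennreal
      by (simp flip: inf_min add: inf_SUP[symmetric] ennreal_SUP_of_nat_eq_top)
    then show ?thesis
      by (subst nn_integral_monotone_convergence_SUP[symmetric])
         (auto simp: incseq_def le_fun_def intro!: min.coboundedI2)
  qed
  have inc: "incseq (\<lambda>n. \<integral>\<^sup>+x. min (u x) (of_nat n) \<partial>lborel)" for u :: "real \<Rightarrow> ennreal"
    unfolding incseq_def by (intro allI impI nn_integral_mono min.mono) auto
  have bdd: "(SUP x. min (u x) (of_nat n)) < top" for u :: "real \<Rightarrow> ennreal" and n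
  proof -
    have "(SUP x. min (u x) (of_nat n)) \<le> of_nat n" by (rule SUP_least) simp
    also have "\<dots> < top" by (simp add: of_nat_less_top)
    finally show ?thesis .
  qed
  have trn: "(\<integral>\<^sup>+x. min (f x) (of_nat n) \<partial>lborel) * (\<integral>\<^sup>+x. min (g x) (of_nat n) \<partial>lborel) \<le> (\<integral>\<^sup>+x. h x \<partial>lborel)\<^sup>2" for n
  proof (rule prekopa_leindler_real_bounded)
    fix x y
    have "min (f x) (of_nat n) * min (g y) (of_nat n) \<le> f x * g y" by (intro mult_mono) auto
    also note le
    finally show "min (f x) (of_nat n) * min (g y) (of_nat n) \<le> (h ((x + y) / 2))\<^sup>2" .
  qed (auto simp: bdd)
  \<comment> \<open>Multiplying the two suprema produces independent cut-offs \<open>m\<close> and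
    \<open>n\<close>; the common cut-off \<open>max m n\<close> dominates both.\<close>
  have "(\<integral>\<^sup>+x. min (f x) (of_nat m) \<partial>lborel) * (\<integral>\<^sup>+x. min (g x) (of_nat n) \<partial>lborel) \<le> (\<integral>\<^sup>+x. h x \<partial>lborel)\<^sup>2" for m n
    by (rule order_trans[OF mult_mono trn[of "max m n"]]) (auto intro: incseqD[OF inc])
  then show ?thesis
    unfolding trunc[OF assms(1)] trunc[OF assms(2)] SUP_mult_left_ennreal SUP_mult_right_ennreal
    by (intro SUP_least) auto
qed

section \<open>Prekopa--Leindler in several variables\<close>

text \<open>Induction on the number of coordinates: with the new coordinate frozen at
  \<open>a\<close>, \<open>b\<close> and \<open>(a + b) / 2\<close>, the induction hypothesis is
  exactly the pointwise condition of the one-dimensional theorem for the functions integrated over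
  the old coordinates.\<close>

lemma prekopa_leindler_PiM:
  fixes f g h :: "('i \<Rightarrow> real) \<Rightarrow> ennreal"
  assumes "finite I"
    and "f \<in> borel_measurable (PiM I (\<lambda>_. lborel))" "g \<in> borel_measurable (PiM I (\<lambda>_. lborel))"
        "h \<in> borel_measurable (PiM I (\<lambda>_. lborel))"
    and "\<And>x y. x \<in> space (PiM I (\<lambda>_. lborel)) \<Longrightarrow> y \<in> space (PiM I (\<lambda>_. lborel)) \<Longrightarrow>
           f x * g y \<le> (h (\<lambda>i\<in>I. (x i + y i) / 2))\<^sup>2"
  shows "(\<integral>\<^sup>+x. f x \<partial>PiM I (\<lambda>_. lborel)) * (\<integral>\<^sup>+x. g x \<partial>PiM I (\<lambda>_. lborel))
    \<le> (\<integral>\<^sup>+x. h x \<partial>PiM I (\<lambda>_. lborel))\<^sup>2"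
  using assms
proof (induction I arbitrary: f g h rule: finite_induct)
  case empty
  interpret product_sigma_finite "\<lambda>_::'i. lborel :: real measure" by standard
  \<comment> \<open>The product over no coordinates is a unit mass at the single point
    \<open>\<lambda>_. undefined\<close>.\<close>
  have "f (\<lambda>_. undefined) * g (\<lambda>_. undefined) \<le> (h (\<lambda>_. undefined))\<^sup>2"
    using empty(4)[of "\<lambda>_. undefined" "\<lambda>_. undefined"] by (simp add: space_PiM restrict_def)
  then show ?case by (simp add: nn_integral_empty)
next
  case (insert i I)
  interpret product_sigma_finite "\<lambda>_::'i. lborel :: real measure" by standard
  interpret F: finite_product_sigma_finite "\<lambda>_::'i. lborel :: real measure" I by standard fact
  note insert.prems(1-3)[measurable]
  have upd: "(\<lambda>(y, x). x(i := y)) \<in> (lborel \<Otimes>\<^sub>M PiM I (\<lambda>_. lborel)) \<rightarrow>\<^sub>M PiM (insert i I) (\<lambda>_. lborel)"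
    by measurable
  have upd1: "(\<lambda>x. x(i := y)) \<in> PiM I (\<lambda>_. lborel) \<rightarrow>\<^sub>M PiM (insert i I) (\<lambda>_. lborel)" for y :: real
    by measurable
  have mi: "(\<lambda>y. \<integral>\<^sup>+x. u (x(i := y)) \<partial>PiM I (\<lambda>_. lborel)) \<in> borel_measurable borel"
    if u: "u \<in> borel_measurable (PiM (insert i I) (\<lambda>_. lborel))" for u :: "('i \<Rightarrow> real) \<Rightarrow> ennreal"
  proof -
    have "(\<lambda>y. \<integral>\<^sup>+x. u (x(i := y)) \<partial>PiM I (\<lambda>_. lborel)) \<in> borel_measurable lborel"
      using measurable_compose[OF upd u] by (intro F.borel_measurable_nn_integral) (simp add: case_prod_unfold)
    then show ?thesis by simp
  qed
  have "(\<integral>\<^sup>+y. \<integral>\<^sup>+x. f (x(i := y)) \<partial>PiM I (\<lambda>_. lborel) \<partial>lborel) * (\<integral>\<^sup>+y. \<integral>\<^sup>+x. g (x(i := y)) \<partial>PiM I (\<lambda>_. lborel) \<partial>lborel)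
     \<le> (\<integral>\<^sup>+y. \<integral>\<^sup>+x. h (x(i := y)) \<partial>PiM I (\<lambda>_. lborel) \<partial>lborel)\<^sup>2"
  proof (rule prekopa_leindler_real[OF mi mi mi])
    fix a b
    show "(\<integral>\<^sup>+x. f (x(i := a)) \<partial>PiM I (\<lambda>_. lborel)) * (\<integral>\<^sup>+x. g (x(i := b)) \<partial>PiM I (\<lambda>_. lborel))
      \<le> (\<integral>\<^sup>+x. h (x(i := (a + b) / 2)) \<partial>PiM I (\<lambda>_. lborel))\<^sup>2"
    proof (rule insert.IH)
      fix x y :: "'i \<Rightarrow> real" assume "x \<in> space (PiM I (\<lambda>_. lborel))" "y \<in> space (PiM I (\<lambda>_. lborel))"
      then have "x(i := a) \<in> space (PiM (insert i I) (\<lambda>_. lborel))" "y(i := b) \<in> space (PiM (insert i I) (\<lambda>_. lborel))"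
        by (auto simp: space_PiM PiE_def extensional_def)
      from insert.prems(4)[OF this]
      have "f (x(i := a)) * g (y(i := b)) \<le> (h (\<lambda>j\<in>insert i I. ((x(i := a)) j + (y(i := b)) j) / 2))\<^sup>2" .
      also have "(\<lambda>j\<in>insert i I. ((x(i := a)) j + (y(i := b)) j) / 2) = (\<lambda>j\<in>I. (x j + y j) / 2)(i := (a + b) / 2)"
        using insert.hyps by (auto simp: fun_eq_iff)
      finally show "f (x(i := a)) * g (y(i := b)) \<le> (h ((\<lambda>j\<in>I. (x j + y j) / 2)(i := (a + b) / 2)))\<^sup>2" .
    qed (rule measurable_compose[OF upd1], fact)+
  qed fact+
  then show ?case
    using insert.hyps by (simp add: product_nn_integral_insert_rev)
qed

text \<open>Lebesgue measure is the image of the product measure under the coordinate map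
  \<open>s\<close>, which is linear and so carries midpoints to midpoints.\<close>

theorem prekopa_leindler:
  fixes f g h :: "'a::euclidean_space \<Rightarrow> ennreal"
  assumes [measurable]: "f \<in> borel_measurable borel" "g \<in> borel_measurable borel" "h \<in> borel_measurable borel"
    and le: "\<And>x y. f x * g y \<le> (h ((x + y) /\<^sub>R 2))\<^sup>2"
  shows "(\<integral>\<^sup>+x. f x \<partial>lborel) * (\<integral>\<^sup>+x. g x \<partial>lborel) \<le> (\<integral>\<^sup>+x. h x \<partial>lborel)\<^sup>2"
proof -
  define P where "P = PiM (Basis :: 'a set) (\<lambda>_. lborel :: real measure)"
  define s :: "('a \<Rightarrow> real) \<Rightarrow> 'a" where "s x = (\<Sum>b\<in>Basis. x b *\<^sub>R b)" for x
  have s[measurable]: "s \<in> P \<rightarrow>\<^sub>M borel" unfolding s_def[abs_def] P_def by measurable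
  have lborel: "lborel = distr P borel s" unfolding s_def[abs_def] P_def by (rule lborel_eq)
  have tr: "(\<integral>\<^sup>+x. u x \<partial>lborel) = (\<integral>\<^sup>+x. u (s x) \<partial>P)" if "u \<in> borel_measurable borel" for u :: "'a \<Rightarrow> ennreal"
    unfolding lborel by (rule nn_integral_distr[OF s]) (simp add: that)
  have mid: "s (\<lambda>i\<in>Basis. (x i + y i) / 2) = (s x + s y) /\<^sub>R 2" for x y
  proof -
    have "s (\<lambda>i\<in>Basis. (x i + y i) / 2) = (\<Sum>b\<in>Basis. (x b *\<^sub>R b + y b *\<^sub>R b) /\<^sub>R 2)"
      unfolding s_def
    proof (rule sum.cong)
      fix b :: 'a assume "b \<in> Basis"
      then show "(\<lambda>i\<in>Basis. (x i + y i) / 2) b *\<^sub>R b = (x b *\<^sub>R b + y b *\<^sub>R b) /\<^sub>R 2"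
        by (simp only: restrict_apply' divide_inverse mult.commute[of _ "inverse 2"]
            scaleR_scaleR[symmetric] scaleR_left_distrib)
    qed simp
    then show ?thesis
      by (simp only: sum.distrib scaleR_sum_right[symmetric] s_def)
  qed
  have "(\<integral>\<^sup>+x. f (s x) \<partial>P) * (\<integral>\<^sup>+x. g (s x) \<partial>P) \<le> (\<integral>\<^sup>+x. h (s x) \<partial>P)\<^sup>2"
    unfolding P_def
    by (rule prekopa_leindler_PiM)
       (use measurable_compose[OF s assms(1)] measurable_compose[OF s assms(2)] measurable_compose[OF s assms(3)] le
         in \<open>simp_all add: P_def mid\<close>)
  then show ?thesis by (simp only: tr assms(1-3))
qed

section \<open>Exponential tilting\<close>

text \<open>By the mean value inequality \<open>B\<close> also bounds the difference quotients, and
  a constant is integrable for a finite measure, so dominated convergence applies along every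
  sequence tending to \<open>t0\<close>.\<close>

lemma (in finite_measure) has_real_derivative_integral:
  fixes g g' :: "real \<Rightarrow> 'a \<Rightarrow> real"
  assumes r: "0 < r"
    and int: "\<And>t. \<bar>t - t0\<bar> < r \<Longrightarrow> integrable M (g t)"
    and meas: "g' t0 \<in> borel_measurable M"
    and der: "\<And>t x. x \<in> space M \<Longrightarrow> \<bar>t - t0\<bar> < r \<Longrightarrow> ((\<lambda>t. g t x) has_real_derivative g' t x) (at t)"
    and bound: "\<And>t x. x \<in> space M \<Longrightarrow> \<bar>t - t0\<bar> < r \<Longrightarrow> \<bar>g' t x\<bar> \<le> B"
  shows "((\<lambda>t. \<integral>x. g t x \<partial>M) has_real_derivative (\<integral>x. g' t0 x \<partial>M)) (at t0)"
proof -
  have int0: "integrable M (g t0)" using int[of t0] r by simp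
  have "((\<lambda>t. \<integral>x. g t x \<partial>M) has_real_derivative (\<integral>x. g' t0 x \<partial>M)) (at t0 within ball t0 r)"
    unfolding has_field_derivative_iff tendsto_at_iff_sequentially
  proof (intro allI impI)
    fix Y :: "nat \<Rightarrow> real" assume Y: "\<forall>i. Y i \<in> ball t0 r - {t0}" "Y \<longlonglongrightarrow> t0"
    then have Yr: "\<bar>Y i - t0\<bar> < r" "Y i \<noteq> t0" for i by (auto simp: dist_real_def abs_minus_commute)
    let ?q = "\<lambda>i x. (g (Y i) x - g t0 x) / (Y i - t0)"
    have "(\<lambda>i. \<integral>x. ?q i x \<partial>M) \<longlonglongrightarrow> (\<integral>x. g' t0 x \<partial>M)"
    proof (rule integral_dominated_convergence[where w="\<lambda>_. B"])
      show "g' t0 \<in> borel_measurable M" by fact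
      show "?q i \<in> borel_measurable M" for i
        using int[OF Yr(1)[of i]] int0 by (intro borel_measurable_divide borel_measurable_diff) auto
      show "AE x in M. (\<lambda>i. ?q i x) \<longlonglongrightarrow> g' t0 x"
      proof (rule AE_I2)
        fix x assume x: "x \<in> space M"
        have "((\<lambda>t. g t x) has_real_derivative g' t0 x) (at t0)" using der[OF x, of t0] r by simp
        then have "((\<lambda>t. (g t x - g t0 x) / (t - t0)) \<longlongrightarrow> g' t0 x) (at t0)"
          by (simp add: has_field_derivative_iff)
        then have "((\<lambda>t. (g t x - g t0 x) / (t - t0)) \<circ> Y) \<longlonglongrightarrow> g' t0 x"
          unfolding tendsto_at_iff_sequentially using Y(2) Yr(2) by auto
        then show "(\<lambda>i. ?q i x) \<longlonglongrightarrow> g' t0 x" by (simp add: o_def)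
      qed
      show "AE x in M. norm (?q i x) \<le> B" for i
      proof (rule AE_I2)
        fix x assume x: "x \<in> space M"
        have "norm (g (Y i) x - g t0 x) \<le> B * norm (Y i - t0)"
        proof (rule field_differentiable_bound[of "ball t0 r" "\<lambda>t. g t x" "\<lambda>t. g' t x"])
          fix t assume "t \<in> ball t0 r"
          then have t: "\<bar>t - t0\<bar> < r" by (simp add: dist_real_def abs_minus_commute)
          show "((\<lambda>t. g t x) has_field_derivative g' t x) (at t within ball t0 r)"
            using der[OF x t] by (rule has_field_derivative_at_within)
          show "norm (g' t x) \<le> B" using bound[OF x t] by simp
        qed (use Y r in auto)
        then show "norm (?q i x) \<le> B" using Yr(2)[of i] by (simp add: field_simps)
      qed
    qed simp
    moreover have "(\<integral>x. ?q i x \<partial>M) = ((\<integral>x. g (Y i) x \<partial>M) - (\<integral>x. g t0 x \<partial>M)) / (Y i - t0)" for i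
      using int[OF Yr(1)[of i]] int0 by simp
    ultimately show "((\<lambda>t. ((\<integral>x. g t x \<partial>M) - (\<integral>x. g t0 x \<partial>M)) / (t - t0)) \<circ> Y) \<longlonglongrightarrow> (\<integral>x. g' t0 x \<partial>M)"
      unfolding o_def by (simp only:)
  qed
  then show ?thesis using r by (simp add: at_within_open[of t0 "ball t0 r"])
qed

text \<open>\<open>G d = L (t + d) * L (t - d)\<close> is largest at \<open>d = 0\<close>, where its
  first derivative vanishes and its second is twice \<open>L t * L2 t - (L1 t)^2\<close>. A positive
  second derivative would make \<open>G\<close> increase to the right of 0. Continuity of
  \<open>L2\<close> is not assumed, so the sign is read off from \<open>G1\<close> near 0.\<close>

lemma midpoint_log_concave_second_derivative:
  fixes L L1 L2 :: "real \<Rightarrow> real"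
  assumes L: "\<And>t. (L has_real_derivative L1 t) (at t)"
    and L1: "\<And>t. (L1 has_real_derivative L2 t) (at t)"
    and mid: "\<And>d. L (t + d) * L (t - d) \<le> (L t)\<^sup>2"
  shows "L t * L2 t \<le> (L1 t)\<^sup>2"
proof (rule ccontr)
  assume neg: "\<not> ?thesis"
  define G where "G d = L (t + d) * L (t - d)" for d
  define G1 where "G1 d = L1 (t + d) * L (t - d) - L (t + d) * L1 (t - d)" for d
  have G: "(G has_real_derivative G1 d) (at d)" for d
    unfolding G_def[abs_def] G1_def
    by (rule derivative_eq_intros DERIV_chain'[OF _ L] refl | simp)+
  have "(G1 has_real_derivative 2 * (L t * L2 t - (L1 t)\<^sup>2)) (at 0)"
    unfolding G1_def[abs_def]
    by (rule derivative_eq_intros DERIV_chain'[OF _ L] DERIV_chain'[OF _ L1] refl | simp add: power2_eq_square)+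
  from DERIV_pos_inc_right[OF this] neg
  obtain d :: real where d: "0 < d" "\<And>h. 0 < h \<Longrightarrow> h < d \<Longrightarrow> G1 0 < G1 h" by auto
  have "G1 0 = 0" by (simp add: G1_def)
  have "G 0 < G (d/2)"
  proof (rule DERIV_pos_imp_increasing_open[where f=G])
    fix x assume "0 < x" "x < d/2"
    then show "\<exists>y. (G has_real_derivative y) (at x) \<and> 0 < y"
      using G[of x] d \<open>G1 0 = 0\<close> by (intro exI[of _ "G1 x"]) auto
  next
    show "continuous_on {0..d/2} G"
      by (intro continuous_at_imp_continuous_on ballI DERIV_isCont[OF G])
  qed (use d in auto)
  moreover have "G (d/2) \<le> G 0" using mid by (simp add: G_def power2_eq_square)
  ultimately show False by simp
qed

text \<open>The hypothesis integrated against the weight \<open>1 - t\<close> on \<open>[0, 1]\<close>.\<close>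

lemma second_order_differential_inequality:
  fixes D D1 D2 :: "real \<Rightarrow> real"
  assumes D: "\<And>t. (D has_real_derivative D1 t) (at t)"
    and D1: "\<And>t. (D1 has_real_derivative D2 t) (at t)"
    and D2: "\<And>t. 0 \<le> D2 t"
    and init: "D 0 = 0" "D1 0 = 0"
    and A: "0 \<le> B"
    and V: "\<And>t. 0 \<le> t \<Longrightarrow> V \<le> A * D2 t + B * D1 t"
  shows "0 \<le> D 1" "V \<le> (2 * A + 2 * B) * D 1"
proof -
  have D1_nn: "0 \<le> D1 t" if "0 \<le> t" for t
    using DERIV_nonneg_imp_nondecreasing[OF that, of D1] D1 D2 init by force
  have D_mono: "D t \<le> D 1" if "0 \<le> t" "t \<le> 1" for t
    using DERIV_nonneg_imp_nondecreasing[OF that(2), of D] D D1_nn that by force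
  show "0 \<le> D 1" using D_mono[of 0] init by simp
  \<comment> \<open>First integration of the hypothesis, from 0 to \<open>t\<close>.\<close>
  have W: "0 \<le> A * D1 t + B * D t - V * t" if t: "0 \<le> t" for t
  proof -
    have "A * D1 0 + B * D 0 - V * 0 \<le> A * D1 t + B * D t - V * t"
    proof (rule DERIV_nonneg_imp_nondecreasing[OF t])
      fix x assume "0 \<le> x" "x \<le> t"
      have "((\<lambda>t. A * D1 t + B * D t - V * t) has_real_derivative A * D2 x + B * D1 x - V) (at x)"
        by (rule derivative_eq_intros D D1 refl | simp)+
      then show "\<exists>y. ((\<lambda>t. A * D1 t + B * D t - V * t) has_real_derivative y) (at x) \<and> 0 \<le> y"
        using V[OF \<open>0 \<le> x\<close>] by (intro exI[of _ "A * D2 x + B * D1 x - V"]) auto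
    qed
    then show ?thesis by (simp add: init)
  qed
  \<comment> \<open>Second integration, over \<open>[0, 1]\<close>, with \<open>D x\<close> replaced
    by its upper bound \<open>D 1\<close>. The term in \<open>V\<close> contributes
    \<open>V / 2\<close>, whence the factor 2 in the conclusion.\<close>
  have "A * D 0 + B * D 1 * 0 - V * 0\<^sup>2 / 2 \<le> A * D 1 + B * D 1 * 1 - V * 1\<^sup>2 / 2"
  proof (rule DERIV_nonneg_imp_nondecreasing[where f="\<lambda>t. A * D t + B * D 1 * t - V * t\<^sup>2 / 2" and a=0 and b=1])
    fix x :: real assume x: "0 \<le> x" "x \<le> 1"
    have "((\<lambda>t. A * D t + B * D 1 * t - V * t\<^sup>2 / 2) has_real_derivative A * D1 x + B * D 1 - V * x) (at x)"
      by (rule derivative_eq_intros D refl | simp)+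
    moreover have "B * D x \<le> B * D 1" using D_mono x A by (intro mult_left_mono) auto
    ultimately show "\<exists>y. ((\<lambda>t. A * D t + B * D 1 * t - V * t\<^sup>2 / 2) has_real_derivative y) (at x) \<and> 0 \<le> y"
      using W[OF x(1)] by (intro exI[of _ "A * D1 x + B * D 1 - V * x"]) auto
  qed simp
  then show "V \<le> (2 * A + 2 * B) * D 1" by (simp add: init algebra_simps)
qed

section \<open>Exponential tilts of a single density\<close>

text \<open>The \<open>j\<close>-th derivative in \<open>t\<close> of the moment generating function
  of \<open>X\<close> under the density \<open>a\<close>. The definitions precede the locale so that
  they can be applied to every member of a family of densities.\<close>

definition exp_moment :: "'a measure \<Rightarrow> ('a \<Rightarrow> real) \<Rightarrow> ('a \<Rightarrow> real) \<Rightarrow> nat \<Rightarrow> real \<Rightarrow> real" where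
  "exp_moment N a X j t = (\<integral>x. X x ^ j * exp (t * X x) * a x \<partial>N)"

definition log_mgf :: "'a measure \<Rightarrow> ('a \<Rightarrow> real) \<Rightarrow> ('a \<Rightarrow> real) \<Rightarrow> real \<Rightarrow> real" where
  "log_mgf N a X t = ln (exp_moment N a X 0 t)"

definition tilted_mean :: "'a measure \<Rightarrow> ('a \<Rightarrow> real) \<Rightarrow> ('a \<Rightarrow> real) \<Rightarrow> real \<Rightarrow> real" where
  "tilted_mean N a X t = exp_moment N a X 1 t / exp_moment N a X 0 t"

definition tilted_square :: "'a measure \<Rightarrow> ('a \<Rightarrow> real) \<Rightarrow> ('a \<Rightarrow> real) \<Rightarrow> real \<Rightarrow> real" where
  "tilted_square N a X t = exp_moment N a X 2 t / exp_moment N a X 0 t"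

text \<open>\<open>X\<close> is normalized to be nonnegative because the monotonicity of its second
  moment along the tilt, \<open>Q_mono_0\<close>, relies on squaring being increasing on the range
  of \<open>X\<close>.\<close>

locale tilt = finite_measure N for N :: "'a measure" +
  fixes a X :: "'a \<Rightarrow> real" and s A :: real
  assumes a_meas[measurable]: "a \<in> borel_measurable N" and X_meas[measurable]: "X \<in> borel_measurable N"
    and a_bound: "\<And>x. x \<in> space N \<Longrightarrow> 0 \<le> a x \<and> a x \<le> A"
    and X_bound: "\<And>x. x \<in> space N \<Longrightarrow> 0 \<le> X x \<and> X x \<le> s"
    and a_int: "(\<integral>x. a x \<partial>N) = 1"
begin

abbreviation "mom \<equiv> exp_moment N a X"
abbreviation "Lam \<equiv> log_mgf N a X"
abbreviation "P \<equiv> tilted_mean N a X"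
abbreviation "Q \<equiv> tilted_square N a X"

lemmas mom_def = exp_moment_def[of N a X]
lemmas Lam_def = log_mgf_def[of N a X]
lemmas P_def = tilted_mean_def[of N a X]
lemmas Q_def = tilted_square_def[of N a X]

lemma space_ne: "space N \<noteq> {}"
proof
  assume "space N = {}"
  then have "(\<integral>x. a x \<partial>N) = (\<integral>x. 0 \<partial>N)" by (intro Bochner_Integration.integral_cong) auto
  then show False using a_int by simp
qed

lemma s_nonneg: "0 \<le> s"
  using space_ne X_bound by fastforce

lemma exp_bound: "x \<in> space N \<Longrightarrow> exp (- (\<bar>t\<bar> * s)) \<le> exp (t * X x) \<and> exp (t * X x) \<le> exp (\<bar>t\<bar> * s)"
proof -
  assume x: "x \<in> space N"
  have "\<bar>t * X x\<bar> \<le> \<bar>t\<bar> * s"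
    unfolding abs_mult using X_bound[OF x] by (intro mult_mono) auto
  then show ?thesis by auto
qed

lemma integrand_bound:
  assumes x: "x \<in> space N"
  shows "0 \<le> X x ^ j * exp (t * X x) * a x" "X x ^ j * exp (t * X x) * a x \<le> s ^ j * exp (\<bar>t\<bar> * s) * A"
  using X_bound[OF x] a_bound[OF x] exp_bound[OF x, of t] s_nonneg
  by (auto intro!: mult_mono power_mono)

lemma integrable_mom: "integrable N (\<lambda>x. X x ^ j * exp (t * X x) * a x)"
  by (rule integrable_const_bound[where B="s ^ j * exp (\<bar>t\<bar> * s) * A"])
     (auto intro!: AE_I2 simp: integrand_bound)

lemma integrable_a: "integrable N a"
  using integrable_mom[of 0 0] by simp

lemma has_derivative_mom: "(mom j has_real_derivative mom (Suc j) t) (at t)"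
proof -
  have "((\<lambda>t. \<integral>x. X x ^ j * exp (t * X x) * a x \<partial>N) has_real_derivative
      (\<integral>x. X x ^ Suc j * exp (t * X x) * a x \<partial>N)) (at t)"
  proof (rule has_real_derivative_integral[where r=1 and B="s ^ Suc j * exp ((\<bar>t\<bar> + 1) * s) * A"])
    fix u x assume x: "x \<in> space N" and u: "\<bar>u - t\<bar> < 1"
    show "((\<lambda>u. X x ^ j * exp (u * X x) * a x) has_real_derivative X x ^ Suc j * exp (u * X x) * a x) (at u)"
      by (rule derivative_eq_intros refl | simp)+
    have "X x ^ Suc j * exp (u * X x) * a x \<le> s ^ Suc j * exp (\<bar>u\<bar> * s) * A"
      by (rule integrand_bound[OF x])
    also have "\<dots> \<le> s ^ Suc j * exp ((\<bar>t\<bar> + 1) * s) * A"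
      using u s_nonneg a_bound[OF x] by (intro mult_right_mono mult_left_mono) (auto intro!: mult_right_mono)
    finally show "\<bar>X x ^ Suc j * exp (u * X x) * a x\<bar> \<le> s ^ Suc j * exp ((\<bar>t\<bar> + 1) * s) * A"
      using integrand_bound(1)[OF x, of "Suc j" u] by simp
  qed (use integrable_mom in auto)
  then show ?thesis by (simp add: mom_def[abs_def])
qed

lemma mom0_bounds: "exp (- (\<bar>t\<bar> * s)) \<le> mom 0 t" "mom 0 t \<le> exp (\<bar>t\<bar> * s)"
proof -
  have "(\<integral>x. exp (- (\<bar>t\<bar> * s)) * a x \<partial>N) \<le> mom 0 t"
    unfolding mom_def using exp_bound a_bound integrable_mom[of 0 t] integrable_a
    by (intro integral_mono) (auto intro!: mult_right_mono)
  then show "exp (- (\<bar>t\<bar> * s)) \<le> mom 0 t" by (simp add: a_int)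
  have "mom 0 t \<le> (\<integral>x. exp (\<bar>t\<bar> * s) * a x \<partial>N)"
    unfolding mom_def using exp_bound a_bound integrable_mom[of 0 t] integrable_a
    by (intro integral_mono) (auto intro!: mult_right_mono)
  then show "mom 0 t \<le> exp (\<bar>t\<bar> * s)" by (simp add: a_int)
qed

lemma mom0_pos: "0 < mom 0 t"
  using mom0_bounds(1)[of t] by (rule less_le_trans[rotated]) simp

lemma Lam_bound: "\<bar>Lam t\<bar> \<le> \<bar>t\<bar> * s"
  using mom0_bounds[of t] mom0_pos[of t] ln_mono[of "mom 0 t" "exp (\<bar>t\<bar> * s)"]
    ln_mono[of "exp (- (\<bar>t\<bar> * s))" "mom 0 t"]
  unfolding Lam_def by (simp add: abs_le_iff)

lemma mom_nonneg: "0 \<le> mom j t"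
  unfolding mom_def by (intro Bochner_Integration.integral_nonneg) (simp add: integrand_bound)

lemma mom_Suc_le: "mom (Suc j) t \<le> s * mom j t"
proof -
  have "mom (Suc j) t \<le> (\<integral>x. s * (X x ^ j * exp (t * X x) * a x) \<partial>N)"
    unfolding mom_def
  proof (rule integral_mono)
    fix x assume x: "x \<in> space N"
    have "X x * (X x ^ j * exp (t * X x) * a x) \<le> s * (X x ^ j * exp (t * X x) * a x)"
      using X_bound[OF x] integrand_bound(1)[OF x] by (intro mult_right_mono) auto
    then show "X x ^ Suc j * exp (t * X x) * a x \<le> s * (X x ^ j * exp (t * X x) * a x)"
      by (simp add: mult.assoc)
  qed (rule integrable_mom integrable_mult_right)+
  then show ?thesis by (simp add: mom_def)
qed

lemma P_bounds: "0 \<le> P t" "P t \<le> s"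
  using mom_nonneg[of 1 t] mom_Suc_le[of 0 t] mom0_pos[of t]
  by (auto simp: P_def divide_le_eq)

lemma Q_le: "Q t \<le> s\<^sup>2"
proof -
  have "mom 2 t \<le> s * mom 1 t" using mom_Suc_le[of 1 t] by (simp add: numeral_2_eq_2)
  also have "\<dots> \<le> s * (s * mom 0 t)"
    using mom_Suc_le[of 0 t] s_nonneg by (intro mult_left_mono) auto
  finally show ?thesis
    using mom0_pos[of t] by (simp add: Q_def divide_le_eq power2_eq_square mult.assoc)
qed

text \<open>Expand the integral of \<open>(X - P t)^2\<close> against the tilted density, which is
  nonnegative.\<close>

lemma P_square_le_Q: "(P t)\<^sup>2 \<le> Q t"
proof -
  let ?p = "P t"
  have "0 \<le> (\<integral>x. (X x - ?p)\<^sup>2 * (exp (t * X x) * a x) \<partial>N)"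
    using a_bound by (intro Bochner_Integration.integral_nonneg) auto
  also have "\<dots> = (\<integral>x. X x ^ 2 * exp (t * X x) * a x - (2 * ?p) * (X x ^ 1 * exp (t * X x) * a x)
      + ?p\<^sup>2 * (X x ^ 0 * exp (t * X x) * a x) \<partial>N)"
    by (intro Bochner_Integration.integral_cong) (auto simp: power2_eq_square algebra_simps)
  also have "\<dots> = mom 2 t - (2 * ?p) * mom 1 t + ?p\<^sup>2 * mom 0 t"
    unfolding mom_def using integrable_mom[of 2 t] integrable_mom[of 1 t] integrable_mom[of 0 t] by simp
  also have "mom 1 t = ?p * mom 0 t" using mom0_pos[of t] by (simp add: P_def)
  also have "mom 2 t = Q t * mom 0 t" using mom0_pos[of t] by (simp add: Q_def)
  finally have "0 \<le> (Q t - ?p\<^sup>2) * mom 0 t" by (simp add: algebra_simps power2_eq_square)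
  then show ?thesis using mom0_pos[of t] by (simp add: zero_le_mult_iff)
qed

lemma has_derivative_Lam: "(Lam has_real_derivative P t) (at t)"
  unfolding Lam_def[abs_def] P_def
  using DERIV_chain'[OF has_derivative_mom DERIV_ln[OF mom0_pos]]
  by (simp add: field_simps)

text \<open>The quotient rule; the derivative of the tilted mean is the tilted variance.\<close>

lemma has_derivative_P: "(P has_real_derivative Q t - (P t)\<^sup>2) (at t)"
proof -
  have "(P has_real_derivative (mom 2 t * mom 0 t - mom 1 t * mom 1 t) / (mom 0 t * mom 0 t)) (at t)"
    unfolding P_def[abs_def] using mom0_pos[of t] has_derivative_mom[of 1 t] has_derivative_mom[of 0 t]
    by (intro DERIV_divide) (auto simp: numeral_2_eq_2)
  moreover have "(mom 2 t * mom 0 t - mom 1 t * mom 1 t) / (mom 0 t * mom 0 t) = Q t - (P t)\<^sup>2"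
    using mom0_pos[of t] by (simp add: P_def Q_def field_simps power2_eq_square)
  ultimately show ?thesis by simp
qed

lemma mom_0_0: "mom 0 0 = 1" by (simp add: mom_def a_int)

text \<open>Chebyshev's correlation inequality: with \<open>mom 0 t = exp (t * l)\<close> the increments
  \<open>X\<^sup>2 - l\<^sup>2\<close> and \<open>exp (t * X) - mom 0 t\<close> have the same sign.\<close>

lemma Q_mono_0:
  assumes t: "0 \<le> t"
  shows "Q 0 \<le> Q t"
proof (cases "t = 0")
  case False
  define l where "l = Lam t / t"
  have Z: "mom 0 t = exp (t * l)" using mom0_pos[of t] False by (simp add: l_def Lam_def)
  \<comment> \<open>This makes \<open>l\<close> nonnegative, so that \<open>(X x)^2 - l^2\<close>
    has the sign of \<open>X x - l\<close>.\<close>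
  have "1 \<le> mom 0 t"
  proof -
    have "(\<integral>x. a x \<partial>N) \<le> mom 0 t"
      unfolding mom_def
    proof (rule integral_mono)
      fix x assume x: "x \<in> space N"
      have "1 * a x \<le> exp (t * X x) * a x"
        using a_bound[OF x] X_bound[OF x] t by (intro mult_right_mono) auto
      then show "a x \<le> X x ^ 0 * exp (t * X x) * a x" by simp
    qed (rule integrable_a integrable_mom)+
    then show ?thesis by (simp add: a_int)
  qed
  then have l: "0 \<le> l" using t False by (simp add: Z zero_le_mult_iff)
  have "0 \<le> (\<integral>x. ((X x)\<^sup>2 - l\<^sup>2) * (exp (t * X x) - mom 0 t) * a x \<partial>N)"
  proof (rule Bochner_Integration.integral_nonneg)
    fix x assume x: "x \<in> space N"
    have "0 \<le> ((X x)\<^sup>2 - l\<^sup>2) * (exp (t * X x) - mom 0 t)"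
    proof (cases "l \<le> X x")
      case True
      then show ?thesis using l t by (intro mult_nonneg_nonneg) (auto simp: Z power_mono mult_left_mono)
    next
      case False
      then show ?thesis using X_bound[OF x] t
        by (intro mult_nonpos_nonpos) (auto simp: Z power_mono mult_left_mono)
    qed
    then show "0 \<le> ((X x)\<^sup>2 - l\<^sup>2) * (exp (t * X x) - mom 0 t) * a x" using a_bound[OF x] by simp
  qed
  \<comment> \<open>The two terms carrying \<open>l^2\<close> cancel after integration, since
    \<open>mom 0 0 = 1\<close>.\<close>
  also have "\<dots> = (\<integral>x. X x ^ 2 * exp (t * X x) * a x - mom 0 t * (X x ^ 2 * exp (0 * X x) * a x)
      - (l\<^sup>2 * (X x ^ 0 * exp (t * X x) * a x) - l\<^sup>2 * mom 0 t * (X x ^ 0 * exp (0 * X x) * a x)) \<partial>N)"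
    by (intro Bochner_Integration.integral_cong) (auto simp: algebra_simps)
  also have "\<dots> = mom 2 t - mom 0 t * mom 2 0 - (l\<^sup>2 * mom 0 t - l\<^sup>2 * mom 0 t * mom 0 0)"
    unfolding mom_def[of 2] mom_def[of 0 0]
    using integrable_mom[of 2 t] integrable_mom[of 2 0] integrable_mom[of 0 t] integrable_mom[of 0 0]
    by (simp add: mom_def[of 0 t])
  finally have "mom 0 t * mom 2 0 \<le> mom 2 t" by (simp add: mom_0_0)
  then show ?thesis using mom0_pos[of t] by (simp add: Q_def mom_0_0 le_divide_eq mult.commute)
qed simp

end

section \<open>Tilts depending on a second variable, and their averaged variances\<close>

text \<open>\<open>a y\<close> plays the conditional density of the first variable given
  \<open>y\<close>, and \<open>n\<close> the density of \<open>y\<close>. The auxiliary weight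
  \<open>w y * exp (- eps * Lam y t)\<close> is the one to which Prekopa--Leindler applies:
  \<open>log_concave\<close> states that its total mass is midpoint log-concave in \<open>t\<close>.
  \<open>comparable\<close> bounds its ratios by a \<open>K\<close> independent of \<open>t\<close>,
  which allows a return from this weight to \<open>n\<close>.\<close>

locale tilt_family = N: finite_measure N + M: finite_measure M
  for N :: "'a measure" and M :: "'b measure" +
  fixes a :: "'b \<Rightarrow> 'a \<Rightarrow> real" and X :: "'a \<Rightarrow> real" and n w :: "'b \<Rightarrow> real"
    and s A lo hi W K eps :: real
  assumes tilt: "\<And>y. y \<in> space M \<Longrightarrow> tilt N (a y) X s A"
    and a_meas2[measurable]: "(\<lambda>(y, x). a y x) \<in> borel_measurable (M \<Otimes>\<^sub>M N)"
    and X_meas[measurable]: "X \<in> borel_measurable N"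
    and n_meas[measurable]: "n \<in> borel_measurable M"
    and n_bounds: "\<And>y. y \<in> space M \<Longrightarrow> lo \<le> n y \<and> n y \<le> hi" and lo: "0 < lo"
    and n_int: "(\<integral>y. n y \<partial>M) = 1"
    and w_meas[measurable]: "w \<in> borel_measurable M"
    and w_bounds: "\<And>y. y \<in> space M \<Longrightarrow> 0 < w y \<and> w y \<le> W"
    and eps: "0 < eps"
    and log_concave: "\<And>t d. (\<integral>y. w y * exp (- eps * log_mgf N (a y) X (t + d)) \<partial>M) *
        (\<integral>y. w y * exp (- eps * log_mgf N (a y) X (t - d)) \<partial>M)
      \<le> (\<integral>y. w y * exp (- eps * log_mgf N (a y) X t) \<partial>M)\<^sup>2"
    and comparable: "\<And>t y y'. y \<in> space M \<Longrightarrow> y' \<in> space M \<Longrightarrow>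
        w y * exp (- eps * log_mgf N (a y) X t) \<le> K * (w y' * exp (- eps * log_mgf N (a y') X t))"
begin

abbreviation "Lam y \<equiv> log_mgf N (a y) X"
abbreviation "P y \<equiv> tilted_mean N (a y) X"
abbreviation "Q y \<equiv> tilted_square N (a y) X"
abbreviation "rho y t \<equiv> w y * exp (- eps * Lam y t)"

lemma measurable_mom[measurable]: "(\<lambda>y. exp_moment N (a y) X j t) \<in> borel_measurable M"
  unfolding exp_moment_def by measurable

lemma measurable_Lam[measurable]: "(\<lambda>y. Lam y t) \<in> borel_measurable M"
  unfolding log_mgf_def by measurable

lemma measurable_P[measurable]: "(\<lambda>y. P y t) \<in> borel_measurable M"
  unfolding tilted_mean_def by measurable

lemma measurable_Q[measurable]: "(\<lambda>y. Q y t) \<in> borel_measurable M"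
  unfolding tilted_square_def by measurable

lemma space_M_ne: "space M \<noteq> {}"
proof
  assume "space M = {}"
  then have "(\<integral>y. n y \<partial>M) = (\<integral>y. 0 \<partial>M)" by (intro Bochner_Integration.integral_cong) auto
  then show False using n_int by simp
qed

lemma s_nonneg: "0 \<le> s"
  using space_M_ne tilt tilt.s_nonneg by fastforce

lemma P_bounds: "y \<in> space M \<Longrightarrow> 0 \<le> P y t \<and> P y t \<le> s"
  using tilt.P_bounds[OF tilt] by auto

lemma V_bounds: "y \<in> space M \<Longrightarrow> 0 \<le> Q y t - (P y t)\<^sup>2 \<and> Q y t - (P y t)\<^sup>2 \<le> s\<^sup>2"
  using tilt.P_square_le_Q[OF tilt, of y t] tilt.Q_le[OF tilt, of y t] zero_le_power2[of "P y t"]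
  by linarith

lemma rho_bounds: "y \<in> space M \<Longrightarrow> 0 < rho y t \<and> rho y t \<le> W * exp (eps * (\<bar>t\<bar> * s))"
proof -
  assume y: "y \<in> space M"
  have "- (eps * Lam y t) \<le> eps * (\<bar>t\<bar> * s)"
    using tilt.Lam_bound[OF tilt[OF y], of t] eps
    by (metis abs_le_iff minus_mult_right mult_le_cancel_left_pos)
  then show ?thesis using w_bounds[OF y] by (auto intro!: mult_mono)
qed

lemma integrable_bounded:
  assumes "f \<in> borel_measurable M" "\<And>y. y \<in> space M \<Longrightarrow> \<bar>f y\<bar> \<le> (B::real)"
  shows "integrable M f"
  using assms by (intro M.integrable_const_bound[where B=B]) auto

lemma n_abs: "y \<in> space M \<Longrightarrow> \<bar>n y\<bar> \<le> hi \<and> 0 < n y"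
  using n_bounds[of y] lo by auto

lemma integrable_n: "integrable M n"
  by (rule integrable_bounded[where B=hi]) (auto simp: n_abs)

lemma integrable_times_n:
  assumes "f \<in> borel_measurable M" "\<And>y. y \<in> space M \<Longrightarrow> \<bar>f y\<bar> \<le> B"
  shows "integrable M (\<lambda>y. f y * n y)"
proof (rule integrable_bounded[where B="B * hi"])
  fix y assume y: "y \<in> space M"
  show "\<bar>f y * n y\<bar> \<le> B * hi"
    unfolding abs_mult using assms(2)[OF y] n_abs[OF y] by (intro mult_mono) auto
qed (use assms in measurable)

lemma integrable_Lam: "integrable M (\<lambda>y. Lam y t * n y)"
  by (rule integrable_times_n[where B="\<bar>t\<bar> * s"]) (auto intro: tilt.Lam_bound[OF tilt])

lemma integrable_P: "integrable M (\<lambda>y. P y t * n y)"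
  by (rule integrable_times_n[where B=s]) (auto simp: P_bounds)

lemma integrable_P2: "integrable M (\<lambda>y. (P y t)\<^sup>2 * n y)"
  by (rule integrable_times_n[where B="s\<^sup>2"]) (auto simp: P_bounds intro!: power_mono)

lemma integrable_Q: "integrable M (\<lambda>y. Q y t * n y)"
proof (rule integrable_times_n[where B="s\<^sup>2"])
  fix y assume y: "y \<in> space M"
  show "\<bar>Q y t\<bar> \<le> s\<^sup>2"
    using tilt.Q_le[OF tilt[OF y], of t] V_bounds[OF y, of t] zero_le_power2[of "P y t"]
    by linarith
qed measurable

lemma integrable_V: "integrable M (\<lambda>y. (Q y t - (P y t)\<^sup>2) * n y)"
  by (rule integrable_times_n[where B="s\<^sup>2"]) (auto simp del: diff_ge_0_iff_ge simp: V_bounds)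

lemma integrable_times_rho:
  assumes "f \<in> borel_measurable M" "\<And>y. y \<in> space M \<Longrightarrow> \<bar>f y\<bar> \<le> B"
  shows "integrable M (\<lambda>y. f y * rho y t)"
proof (rule integrable_bounded[where B="B * (W * exp (eps * (\<bar>t\<bar> * s)))"])
  fix y assume y: "y \<in> space M"
  show "\<bar>f y * rho y t\<bar> \<le> B * (W * exp (eps * (\<bar>t\<bar> * s)))"
    unfolding abs_mult[of "f y"] using assms(2)[OF y] rho_bounds[OF y, of t] by (intro mult_mono) auto
qed (use assms in measurable)

lemma integrable_rho: "integrable M (\<lambda>y. rho y t)"
  using integrable_times_rho[of "\<lambda>_. 1" 1] by simp

lemma integrable_P_rho: "integrable M (\<lambda>y. P y t * rho y t)"
  by (rule integrable_times_rho[where B=s]) (auto simp: P_bounds)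

lemma integrable_P2_rho: "integrable M (\<lambda>y. (P y t)\<^sup>2 * rho y t)"
  by (rule integrable_times_rho[where B="s\<^sup>2"]) (auto simp: P_bounds intro!: power_mono)

lemma integrable_V_rho: "integrable M (\<lambda>y. (Q y t - (P y t)\<^sup>2) * rho y t)"
  by (rule integrable_times_rho[where B="s\<^sup>2"]) (auto simp del: diff_ge_0_iff_ge simp: V_bounds)

definition EL where "EL t = (\<integral>y. Lam y t * n y \<partial>M)"
definition EP where "EP t = (\<integral>y. P y t * n y \<partial>M)"
definition EV where "EV t = (\<integral>y. (Q y t - (P y t)\<^sup>2) * n y \<partial>M)"

lemma has_derivative_EL: "(EL has_real_derivative EP t) (at t)"
proof -
  have "((\<lambda>t. \<integral>y. Lam y t * n y \<partial>M) has_real_derivative (\<integral>y. P y t * n y \<partial>M)) (at t)"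
  proof (rule M.has_real_derivative_integral[where r=1 and B="s * hi"])
    fix y u assume y: "y \<in> space M"
    show "((\<lambda>u. Lam y u * n y) has_real_derivative P y u * n y) (at u)"
      by (rule DERIV_cmult_right[OF tilt.has_derivative_Lam[OF tilt[OF y]]])
    show "\<bar>P y u * n y\<bar> \<le> s * hi"
      unfolding abs_mult using P_bounds[OF y, of u] n_abs[OF y] by (intro mult_mono) auto
  qed (auto simp: integrable_Lam)
  then show ?thesis by (simp add: EL_def[abs_def] EP_def)
qed

lemma has_derivative_EP: "(EP has_real_derivative EV t) (at t)"
proof -
  have "((\<lambda>t. \<integral>y. P y t * n y \<partial>M) has_real_derivative (\<integral>y. (Q y t - (P y t)\<^sup>2) * n y \<partial>M)) (at t)"
  proof (rule M.has_real_derivative_integral[where r=1 and B="s\<^sup>2 * hi"])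
    fix y u assume y: "y \<in> space M"
    show "((\<lambda>u. P y u * n y) has_real_derivative (Q y u - (P y u)\<^sup>2) * n y) (at u)"
      by (rule DERIV_cmult_right[OF tilt.has_derivative_P[OF tilt[OF y]]])
    show "\<bar>(Q y u - (P y u)\<^sup>2) * n y\<bar> \<le> s\<^sup>2 * hi"
      unfolding abs_mult using V_bounds[OF y, of u] n_abs[OF y] by (intro mult_mono) auto
  qed (auto simp: integrable_P)
  then show ?thesis by (simp add: EP_def[abs_def] EV_def)
qed

lemma EV_nonneg: "0 \<le> EV t"
  unfolding EV_def using V_bounds n_abs by (intro Bochner_Integration.integral_nonneg mult_nonneg_nonneg) (auto intro: less_imp_le)

lemma has_derivative_rho:
  assumes y: "y \<in> space M"
  shows "(rho y has_real_derivative - eps * P y t * rho y t) (at t)"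
  by (rule derivative_eq_intros tilt.has_derivative_Lam[OF tilt[OF y]] refl | simp)+

lemma rho_local_bound:
  assumes y: "y \<in> space M" and u: "\<bar>u - t\<bar> < 1"
  shows "\<bar>rho y u\<bar> \<le> W * exp (eps * ((\<bar>t\<bar> + 1) * s))"
proof -
  have "rho y u \<le> W * exp (eps * (\<bar>u\<bar> * s))" using rho_bounds[OF y] by auto
  also have "\<dots> \<le> W * exp (eps * ((\<bar>t\<bar> + 1) * s))"
    using u w_bounds[OF y] eps s_nonneg by (intro mult_left_mono) (auto intro!: mult_left_mono mult_right_mono)
  finally show ?thesis using rho_bounds[OF y, of u] by simp
qed

text \<open>The infinitesimal form of \<open>log_concave\<close>: a Brascamp--Lieb inequality for \<open>rho\<close>.\<close>

lemma variance_rho_le: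
  "eps * ((\<integral>y. rho y t \<partial>M) * (\<integral>y. (P y t)\<^sup>2 * rho y t \<partial>M) - (\<integral>y. P y t * rho y t \<partial>M)\<^sup>2)
    \<le> (\<integral>y. rho y t \<partial>M) * (\<integral>y. (Q y t - (P y t)\<^sup>2) * rho y t \<partial>M)"
proof -
  define L where "L t = (\<integral>y. rho y t \<partial>M)" for t
  define L1 where "L1 t = (\<integral>y. - eps * P y t * rho y t \<partial>M)" for t
  \<comment> \<open>Product rule for \<open>- eps * P * rho\<close>, with
    \<open>rho' = - eps * P * rho\<close> and \<open>P' = Q - P^2\<close>.\<close>
  define L2 where "L2 t = (\<integral>y. (eps\<^sup>2 * (P y t)\<^sup>2 - eps * (Q y t - (P y t)\<^sup>2)) * rho y t \<partial>M)" for t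
  have epsP: "\<bar>- eps * P y u\<bar> \<le> eps * s" if "y \<in> space M" for y u
    unfolding abs_mult using P_bounds[OF that, of u] eps by (intro mult_mono) auto
  have epsQ: "\<bar>eps\<^sup>2 * (P y u)\<^sup>2 - eps * (Q y u - (P y u)\<^sup>2)\<bar> \<le> eps\<^sup>2 * s\<^sup>2 + eps * s\<^sup>2" if "y \<in> space M" for y u
  proof -
    have "\<bar>eps\<^sup>2 * (P y u)\<^sup>2\<bar> \<le> eps\<^sup>2 * s\<^sup>2" "\<bar>eps * (Q y u - (P y u)\<^sup>2)\<bar> \<le> eps * s\<^sup>2"
      unfolding abs_mult using P_bounds[OF that, of u] V_bounds[OF that, of u] eps
      by (auto intro!: mult_left_mono power_mono)
    then show ?thesis by linarith
  qed
  have L: "(L has_real_derivative L1 t) (at t)" for t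
    unfolding L_def[abs_def] L1_def
  proof (rule M.has_real_derivative_integral[where r=1 and B="eps * s * (W * exp (eps * ((\<bar>t\<bar> + 1) * s)))"])
    fix y u assume y: "y \<in> space M" and u: "\<bar>u - t\<bar> < 1"
    show "(rho y has_real_derivative - eps * P y u * rho y u) (at u)"
      by (rule has_derivative_rho[OF y])
    show "\<bar>- eps * P y u * rho y u\<bar> \<le> eps * s * (W * exp (eps * ((\<bar>t\<bar> + 1) * s)))"
      unfolding abs_mult[of "- eps * P y u"] using epsP[OF y] rho_local_bound[OF y u] eps s_nonneg
      by (intro mult_mono) auto
  qed (use integrable_times_rho[of "\<lambda>_. 1" 1] in \<open>simp_all\<close>)
  have L1: "(L1 has_real_derivative L2 t) (at t)" for t
    unfolding L1_def[abs_def] L2_def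
  proof (rule M.has_real_derivative_integral[where r=1 and
        B="(eps\<^sup>2 * s\<^sup>2 + eps * s\<^sup>2) * (W * exp (eps * ((\<bar>t\<bar> + 1) * s)))"])
    fix y u assume y: "y \<in> space M" and u: "\<bar>u - t\<bar> < 1"
    have "((\<lambda>u. (- eps * P y u) * rho y u) has_real_derivative
        (- eps * (Q y u - (P y u)\<^sup>2)) * rho y u + (- eps * P y u * rho y u) * (- eps * P y u)) (at u)"
      by (rule DERIV_mult DERIV_cmult tilt.has_derivative_P[OF tilt[OF y]] has_derivative_rho[OF y])+
    also have "(- eps * (Q y u - (P y u)\<^sup>2)) * rho y u + (- eps * P y u * rho y u) * (- eps * P y u)
      = (eps\<^sup>2 * (P y u)\<^sup>2 - eps * (Q y u - (P y u)\<^sup>2)) * rho y u"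
      by (simp add: power2_eq_square algebra_simps)
    finally show "((\<lambda>u. - eps * P y u * rho y u) has_real_derivative
        (eps\<^sup>2 * (P y u)\<^sup>2 - eps * (Q y u - (P y u)\<^sup>2)) * rho y u) (at u)" .
    show "\<bar>(eps\<^sup>2 * (P y u)\<^sup>2 - eps * (Q y u - (P y u)\<^sup>2)) * rho y u\<bar>
       \<le> (eps\<^sup>2 * s\<^sup>2 + eps * s\<^sup>2) * (W * exp (eps * ((\<bar>t\<bar> + 1) * s)))"
      unfolding abs_mult[of "eps\<^sup>2 * (P y u)\<^sup>2 - eps * (Q y u - (P y u)\<^sup>2)"]
      using epsQ[OF y] rho_local_bound[OF y u] eps by (intro mult_mono) auto
  next
    fix u show "integrable M (\<lambda>y. - eps * P y u * rho y u)"
      by (rule integrable_times_rho[where B="eps * s"]) (use epsP in auto)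
  qed measurable
  have "L t * L2 t \<le> (L1 t)\<^sup>2"
    by (rule midpoint_log_concave_second_derivative[OF L L1]) (use log_concave in \<open>simp add: L_def\<close>)
  moreover have "L1 t = - eps * (\<integral>y. P y t * rho y t \<partial>M)"
    unfolding L1_def by (simp add: mult.assoc)
  moreover have "L2 t = eps\<^sup>2 * (\<integral>y. (P y t)\<^sup>2 * rho y t \<partial>M) - eps * (\<integral>y. (Q y t - (P y t)\<^sup>2) * rho y t \<partial>M)"
    unfolding L2_def left_diff_distrib[of "eps\<^sup>2 * _"] mult.assoc
    using integrable_P2_rho[of t] integrable_V_rho[of t] by simp
  \<comment> \<open>The terms from \<open>P^2\<close> and from the square of \<open>L1\<close> carry
    \<open>eps^2\<close>, the conditional variance only \<open>eps\<close>; cancelling one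
    \<open>eps\<close> leaves the gain by \<open>1 / eps\<close>.\<close>
  ultimately have "eps * (eps * (L t * (\<integral>y. (P y t)\<^sup>2 * rho y t \<partial>M) - (\<integral>y. P y t * rho y t \<partial>M)\<^sup>2))
    \<le> eps * (L t * (\<integral>y. (Q y t - (P y t)\<^sup>2) * rho y t \<partial>M))"
    by (simp add: power2_eq_square algebra_simps)
  then show ?thesis using eps by (simp add: L_def)
qed

text \<open>With \<open>I\<close> the infimum of \<open>rho\<close>,
  \<open>n <= hi / I * rho\<close> bounds the variance under \<open>n\<close> by a second moment
  under \<open>rho\<close>; then \<open>variance_rho_le\<close> applies, and
  \<open>rho <= K * I / lo * n\<close> leads back to \<open>n\<close>. The infimum cancels, leaving
  \<open>hi / lo * K / eps\<close>.\<close>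

lemma variance_n_le:
  "(\<integral>y. (P y t)\<^sup>2 * n y \<partial>M) - (EP t)\<^sup>2 \<le> hi / lo * K / eps * EV t"
proof -
  obtain y0 where y0: "y0 \<in> space M" using space_M_ne by auto
  have K: "0 < K"
    using comparable[OF y0 y0, of t] rho_bounds[OF y0, of t] by (metis less_le_trans zero_less_mult_pos2)
  define I where "I = (INF y\<in>space M. rho y t)"
  have bdd: "bdd_below ((\<lambda>y. rho y t) ` space M)"
    using rho_bounds by (intro bdd_belowI[where m=0]) (auto intro: less_imp_le)
  have I_le: "I \<le> rho y t" if "y \<in> space M" for y
    unfolding I_def by (rule cINF_lower[OF bdd that])
  have le_I: "rho y t \<le> K * I" if y: "y \<in> space M" for y
  proof -
    have "rho y t / K \<le> I"
      unfolding I_def using comparable[OF y, of _ t] K space_M_ne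
      by (intro cINF_greatest) (auto simp: field_simps)
    then show ?thesis using K by (simp add: field_simps)
  qed
  have I: "0 < I"
    using le_I[OF y0] rho_bounds[OF y0, of t] K by (metis less_le_trans zero_less_mult_pos)
  define r where "r = (\<integral>y. rho y t \<partial>M)"
  \<comment> \<open>Positivity of the total mass \<open>r\<close> of \<open>rho\<close> is obtained
    by comparison with \<open>n\<close>, whose integral is 1.\<close>
  have "(\<integral>y. I / hi * n y \<partial>M) \<le> r"
    unfolding r_def
  proof (rule integral_mono)
    fix y assume y: "y \<in> space M"
    have "n y / hi \<le> 1" "0 \<le> n y / hi" using n_abs[OF y] by (auto simp: divide_le_eq_1)
    then have "I * (n y / hi) \<le> rho y t"
      using I_le[OF y] I by (metis (no_types, opaque_lifting) mult.right_neutral mult_left_mono order_trans less_imp_le)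
    then show "I / hi * n y \<le> rho y t" by simp
  qed (use integrable_rho integrable_n in auto)
  then have "I / hi \<le> r" using n_int by simp
  moreover have hi: "0 < hi" using n_abs[OF y0] by linarith
  ultimately have r: "0 < r"
    using divide_pos_pos[OF I hi] by linarith
  \<comment> \<open>The centre is the mean under \<open>rho\<close>, so that the centred second
    moment under \<open>rho\<close> is precisely the variance in
    \<open>variance_rho_le\<close>.\<close>
  define c where "c = (\<integral>y. P y t * rho y t \<partial>M) / r"
  have c: "(\<integral>y. P y t * rho y t \<partial>M) = c * r" using r by (simp add: c_def)
  have sq: "(\<integral>y. (P y t - c)\<^sup>2 * f y \<partial>M) = (\<integral>y. (P y t)\<^sup>2 * f y \<partial>M) - 2 * c * (\<integral>y. P y t * f y \<partial>M) + c\<^sup>2 * (\<integral>y. f y \<partial>M)"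
    if [simp]: "integrable M (\<lambda>y. (P y t)\<^sup>2 * f y)" "integrable M (\<lambda>y. P y t * f y)" "integrable M f" for f
  proof -
    have "(\<integral>y. (P y t - c)\<^sup>2 * f y \<partial>M) = (\<integral>y. (P y t)\<^sup>2 * f y - 2 * c * (P y t * f y) + c\<^sup>2 * f y \<partial>M)"
      by (intro Bochner_Integration.integral_cong) (auto simp: power2_eq_square algebra_simps)
    then show ?thesis by simp
  qed
  have sq_integrable: "integrable M (\<lambda>y. (P y t - c)\<^sup>2 * f y)"
    if "integrable M (\<lambda>y. (P y t)\<^sup>2 * f y)" "integrable M (\<lambda>y. P y t * f y)" "integrable M f" for f
  proof -
    have "integrable M (\<lambda>y. (P y t)\<^sup>2 * f y - 2 * c * (P y t * f y) + c\<^sup>2 * f y)"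
      using that by auto
    then show ?thesis by (simp add: power2_eq_square algebra_simps)
  qed
  \<comment> \<open>Under \<open>n\<close>, the second moment about any centre is at least the
    variance.\<close>
  have "0 \<le> (EP t - c)\<^sup>2" by simp
  then have "2 * c * EP t \<le> c\<^sup>2 + (EP t)\<^sup>2" by (simp add: power2_diff algebra_simps)
  then have "(\<integral>y. (P y t)\<^sup>2 * n y \<partial>M) - (EP t)\<^sup>2 \<le> (\<integral>y. (P y t - c)\<^sup>2 * n y \<partial>M)"
    unfolding sq[OF integrable_P2 integrable_P integrable_n] n_int EP_def[symmetric] by simp
  also have "\<dots> \<le> (\<integral>y. hi / I * ((P y t - c)\<^sup>2 * rho y t) \<partial>M)"
  proof (rule integral_mono)
    fix y assume y: "y \<in> space M"
    have "n y * I \<le> hi * rho y t"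
      using n_abs[OF y] I_le[OF y] I by (intro mult_mono) auto
    then have "n y \<le> hi / I * rho y t" using I by (simp add: field_simps)
    then have "(P y t - c)\<^sup>2 * n y \<le> (P y t - c)\<^sup>2 * (hi / I * rho y t)" by (rule mult_left_mono) simp
    then show "(P y t - c)\<^sup>2 * n y \<le> hi / I * ((P y t - c)\<^sup>2 * rho y t)" by (simp add: ac_simps)
  qed (intro integrable_mult_right sq_integrable integrable_P2 integrable_P integrable_n
      integrable_P2_rho integrable_P_rho integrable_rho)+
  also have "\<dots> = hi / I * (\<integral>y. (P y t - c)\<^sup>2 * rho y t \<partial>M)" by simp
  also have "(\<integral>y. (P y t - c)\<^sup>2 * rho y t \<partial>M) = (\<integral>y. (P y t)\<^sup>2 * rho y t \<partial>M) - c\<^sup>2 * r"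
    unfolding sq[OF integrable_P2_rho integrable_P_rho integrable_rho] c r_def[symmetric]
    by (simp add: power2_eq_square)
  also have "\<dots> \<le> (\<integral>y. (Q y t - (P y t)\<^sup>2) * rho y t \<partial>M) / eps"
  proof -
    have "r * (eps * ((\<integral>y. (P y t)\<^sup>2 * rho y t \<partial>M) - c\<^sup>2 * r)) \<le> r * (\<integral>y. (Q y t - (P y t)\<^sup>2) * rho y t \<partial>M)"
      using variance_rho_le[of t] unfolding c r_def[symmetric] by (simp add: power2_eq_square algebra_simps)
    then show ?thesis using r eps by (simp add: pos_le_divide_eq mult.commute)
  qed
  also have "(\<integral>y. (Q y t - (P y t)\<^sup>2) * rho y t \<partial>M) \<le> (\<integral>y. K * I / lo * ((Q y t - (P y t)\<^sup>2) * n y) \<partial>M)"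
  proof (rule integral_mono[OF integrable_V_rho])
    fix y assume y: "y \<in> space M"
    have "rho y t * lo \<le> K * I * n y"
      using n_bounds[OF y] lo K I by (intro mult_mono[OF le_I[OF y]]) auto
    then have "rho y t \<le> K * I / lo * n y" using lo by (simp add: field_simps)
    then have "(Q y t - (P y t)\<^sup>2) * rho y t \<le> (Q y t - (P y t)\<^sup>2) * (K * I / lo * n y)"
      using V_bounds[OF y, of t] by (intro mult_left_mono) auto
    then show "(Q y t - (P y t)\<^sup>2) * rho y t \<le> K * I / lo * ((Q y t - (P y t)\<^sup>2) * n y)" by (simp add: ac_simps)
  qed (intro integrable_mult_right integrable_V)
  also have "\<dots> = K * I / lo * EV t" by (simp add: EV_def)
  finally show ?thesis
    using I eps hi by (simp add: divide_right_mono mult_left_mono field_simps)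
qed

text \<open>\<open>D t = EL t - t * EP 0\<close> has \<open>D 0 = D' 0 = 0\<close> and
  \<open>D'' = EV\<close>. The differential inequality is applied with coefficients
  \<open>1 + hi / lo * K / eps\<close> and \<open>2 * s\<close>, and doubles them.\<close>

theorem variance_bound:
  "0 \<le> EL 1 - EP 0"
  "(\<integral>y. Q y 0 * n y \<partial>M) - (EP 0)\<^sup>2 \<le> (2 + 2 * (hi / lo * K / eps) + 4 * s) * (EL 1 - EP 0)"
proof -
  define D where "D t = EL t - t * EP 0" for t
  have EP_mono: "EP 0 \<le> EP t" if "0 \<le> t" for t
    using DERIV_nonneg_imp_nondecreasing[OF that, of EP] has_derivative_EP EV_nonneg by blast
  have EP_le: "EP t \<le> s" for t
  proof -
    have "EP t \<le> (\<integral>y. s * n y \<partial>M)"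
      unfolding EP_def using P_bounds n_abs
      by (intro integral_mono integrable_P integrable_mult_right integrable_n mult_right_mono) (auto intro: less_imp_le)
    then show ?thesis by (simp add: n_int)
  qed
  have EL0: "EL 0 = 0"
    unfolding EL_def log_mgf_def
    using tilt.mom_0_0[OF tilt] by (intro integral_eq_zero_AE AE_I2) auto
  have D': "(D has_real_derivative EP t - EP 0) (at t)" for t
    unfolding D_def[abs_def] by (rule derivative_eq_intros has_derivative_EL refl | simp)+
  have D'': "((\<lambda>t. EP t - EP 0) has_real_derivative EV t) (at t)" for t
    by (rule derivative_eq_intros has_derivative_EP refl | simp)+
  let ?V = "(\<integral>y. Q y 0 * n y \<partial>M) - (EP 0)\<^sup>2"
  have V: "?V \<le> (1 + hi / lo * K / eps) * EV t + 2 * s * (EP t - EP 0)" if t: "0 \<le> t" for t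
  proof -
    \<comment> \<open>Chain: the second moment grows along the tilt; by the law of total variance it
      splits into the mean conditional variance and the second moment of the conditional means; the
      latter is controlled by \<open>variance_n_le\<close>.\<close>
    have "(\<integral>y. Q y 0 * n y \<partial>M) \<le> (\<integral>y. Q y t * n y \<partial>M)"
      using tilt.Q_mono_0[OF tilt t] n_abs
      by (intro integral_mono integrable_Q mult_right_mono) (auto intro: less_imp_le)
    also have "\<dots> = EV t + (\<integral>y. (P y t)\<^sup>2 * n y \<partial>M)"
      unfolding EV_def left_diff_distrib using integrable_Q integrable_P2 by simp
    also have "\<dots> \<le> EV t + (hi / lo * K / eps * EV t + (EP t)\<^sup>2)"
      using variance_n_le[of t] by simp
    finally have "?V \<le> EV t + hi / lo * K / eps * EV t + ((EP t)\<^sup>2 - (EP 0)\<^sup>2)" by simp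
    also have "(EP t)\<^sup>2 - (EP 0)\<^sup>2 = (EP t + EP 0) * (EP t - EP 0)" by (simp add: power2_eq_square algebra_simps)
    also have "\<dots> \<le> (2 * s) * (EP t - EP 0)"
      using EP_mono[OF t] EP_le[of t] EP_le[of 0] by (intro mult_right_mono) auto
    finally show ?thesis by (simp add: algebra_simps)
  qed
  note * = second_order_differential_inequality[OF D' D'' EV_nonneg _ _ _ V]
  show "0 \<le> EL 1 - EP 0" using *(1) s_nonneg by (simp add: D_def EL0)
  show "?V \<le> (2 + 2 * (hi / lo * K / eps) + 4 * s) * (EL 1 - EP 0)"
    using *(2) s_nonneg by (simp add: D_def EL0 distrib_left)
qed

end

section \<open>The torus and the periodic heat kernel\<close>

lemma lattice_add: "k \<in> lattice \<Longrightarrow> l \<in> lattice \<Longrightarrow> k + l \<in> lattice"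
  and lattice_diff: "k \<in> lattice \<Longrightarrow> l \<in> lattice \<Longrightarrow> k - l \<in> lattice"
  and lattice_uminus: "k \<in> lattice \<Longrightarrow> - k \<in> lattice"
  and lattice_0: "0 \<in> lattice"
  by (auto simp: lattice_def)

lemma translate_into_cube:
  fixes x :: "real^'d"
  obtains k where "k \<in> lattice" "x + (2*pi) *\<^sub>R k \<in> cube"
proof -
  define q where "q i = real_of_int \<lfloor>x $ i / (2*pi)\<rfloor>" for i
  define k :: "real^'d" where "k = (\<chi> i. - q i)"
  have "k \<in> lattice" by (simp add: lattice_def k_def q_def)
  moreover have "x + (2*pi) *\<^sub>R k \<in> cube"
    unfolding cube_def mem_box_cart
  proof
    fix i
    have "q i \<le> x $ i / (2*pi)" "x $ i / (2*pi) \<le> q i + 1" unfolding q_def by linarith+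
    then have "2*pi * q i \<le> x $ i" "x $ i \<le> 2*pi * (q i + 1)"
      by (simp_all add: field_simps)
    then show "(0::real^'d) $ i \<le> (x + (2*pi) *\<^sub>R k) $ i \<and> (x + (2*pi) *\<^sub>R k) $ i \<le> ((\<chi> i. 2*pi) :: real^'d) $ i"
      by (simp add: k_def algebra_simps)
  qed
  ultimately show ?thesis by (rule that)
qed

lemma compact_cube: "compact cube" and convex_cube: "convex cube" and sets_cube[measurable]: "cube \<in> sets borel"
  by (auto simp: cube_def)

lemma zero_in_cube: "0 \<in> cube"
  by (simp add: cube_def mem_box_cart)

lemma tper_cube:
  assumes "tper f"
  obtains z where "z \<in> cube" "f z = f x"
  using translate_into_cube[of x] assms unfolding tper_def by metis

lemma norm_diff_cube:
  fixes x y :: "real^'d"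
  assumes "x \<in> cube" "y \<in> cube"
  shows "(norm (x - y))\<^sup>2 \<le> 4 * pi\<^sup>2 * real CARD('d)"
proof -
  have "(norm (x - y))\<^sup>2 = (\<Sum>i\<in>UNIV. (x $ i - y $ i)\<^sup>2)"
    unfolding power2_norm_eq_inner inner_vec_def by (simp add: power2_eq_square)
  also have "\<dots> \<le> (\<Sum>i\<in>(UNIV::'d set). (2*pi)\<^sup>2)"
  proof (rule sum_mono)
    fix i
    have "\<bar>x $ i - y $ i\<bar> \<le> 2*pi"
      using assms by (auto simp: cube_def mem_box_cart abs_le_iff dest!: spec[of _ i])
    then show "(x $ i - y $ i)\<^sup>2 \<le> (2*pi)\<^sup>2"
      by (metis abs_ge_zero power2_abs power_mono)
  qed
  also have "\<dots> = 4 * pi\<^sup>2 * real CARD('d)" by (simp add: power_mult_distrib)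
  finally show ?thesis .
qed

lemma tcont_attains_inf:
  assumes "tcont f"
  shows "\<exists>z. \<forall>x. f z \<le> f x"
proof -
  have "continuous_on cube f" using assms by (auto simp: tcont_def intro: continuous_on_subset)
  then obtain z where z: "\<And>x. x \<in> cube \<Longrightarrow> f z \<le> f x"
    using continuous_attains_inf[OF compact_cube, of f] zero_in_cube by blast
  have "f z \<le> f x" for x
    using tper_cube[of f x] assms z unfolding tcont_def by metis
  then show ?thesis by blast
qed

lemma tcont_uminus: "tcont f \<Longrightarrow> tcont (\<lambda>x. - f x)"
  by (auto simp: tcont_def tper_def intro!: continuous_intros)

lemma tcont_bounded:
  assumes "tcont f"
  obtains B where "\<And>x. \<bar>f x\<bar> \<le> B"
proof -
  obtain z where z: "\<And>x. f z \<le> f x" using tcont_attains_inf[OF assms] by blast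
  obtain z' where z': "\<And>x. - f z' \<le> - f x" using tcont_attains_inf[OF tcont_uminus[OF assms]] by blast
  have "\<bar>f x\<bar> \<le> \<bar>f z\<bar> + \<bar>f z'\<bar>" for x using z[of x] z'[of x] by linarith
  then show ?thesis using that by blast
qed

lemma tcont_osc:
  assumes "tcont f"
  shows "(INF x. f x) \<le> f x" "f x - (INF x. f x) \<le> osc f"
proof -
  obtain B where B: "\<And>x. \<bar>f x\<bar> \<le> B" using tcont_bounded[OF assms] by blast
  have "bdd_below (range f)" using B by (intro bdd_belowI[where m="- B"]) (auto simp: abs_le_iff minus_le_iff)
  then show "(INF x. f x) \<le> f x" by (simp add: cINF_lower)
  have "bdd_above (range f)" using B by (intro bdd_aboveI[where M="B"]) (auto simp: abs_le_iff)
  then have "f x \<le> (SUP x. f x)" by (simp add: cSUP_upper)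
  then show "f x - (INF x. f x) \<le> osc f" by (simp add: osc_def)
qed

text \<open>A semiconcave function cannot rise much above its infimum \<open>b\<close> within one
  period: take \<open>m\<close> in the cube with \<open>g m\<close> close to \<open>b\<close> and
  test semiconcavity at \<open>m\<close> in the direction of \<open>z\<close>. Working with the
  infimum avoids any continuity of \<open>g\<close>.\<close>

lemma periodic_semiconcave_osc:
  fixes g :: "real^'d \<Rightarrow> real"
  assumes per: "tper g" and bdd: "bdd_below (g ` cube)"
    and semi: "\<And>m w. g (m + w) + g (m - w) - (norm w)\<^sup>2 \<le> 2 * g m"
    and z: "z \<in> cube" "z' \<in> cube"
  shows "g z \<le> g z' + 4 * pi\<^sup>2 * real CARD('d)"
proof -
  define b where "b = (INF y\<in>cube. g y)"
  have b: "b \<le> g y" for y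
  proof -
    obtain y' where "y' \<in> cube" "g y' = g y" using tper_cube[OF per] by blast
    then show ?thesis using cINF_lower[OF bdd, of y'] by (simp add: b_def)
  qed
  have "(g z + b - 4 * pi\<^sup>2 * real CARD('d)) / 2 \<le> b"
    unfolding b_def
  proof (rule cINF_greatest)
    fix m :: "real^'d" assume m: "m \<in> cube"
    \<comment> \<open>The reflected point may lie outside the cube; periodicity still gives
      \<open>g >= b\<close> there.\<close>
    have "g z + g (m - (z - m)) - (norm (z - m))\<^sup>2 \<le> 2 * g m"
      using semi[of m "z - m"] by simp
    moreover have "b \<le> g (m - (z - m))" by (rule b)
    ultimately show "(g z + (INF y\<in>cube. g y) - 4 * pi\<^sup>2 * real CARD('d)) / 2 \<le> g m"
      using norm_diff_cube[OF z(1) m] by (simp add: b_def[symmetric])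
  qed (use zero_in_cube in auto)
  then show ?thesis using b[of z'] by simp
qed

section \<open>Gaussian sums over the lattice\<close>

text \<open>For integers the square of \<open>j\<close> is at least its absolute value, so two
  geometric series dominate, one for each sign; the term \<open>j = 0\<close> is counted
  twice.\<close>

lemma sum_exp_abs_le:
  fixes c :: real
  assumes "0 < c"
  shows "(\<Sum>j\<in>{- int N..int N}. exp (- c * (real_of_int j)\<^sup>2)) \<le> 2 / (1 - exp (- c))"
proof -
  let ?r = "exp (- c)"
  have term_le: "exp (- c * (real_of_int j)\<^sup>2) \<le> ?r ^ nat \<bar>j\<bar>" for j
  proof -
    have "real (nat \<bar>j\<bar>) \<le> (real_of_int j)\<^sup>2"
    proof (cases "j = 0")
      case False
      then have "1 \<le> \<bar>real_of_int j\<bar>" by linarith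
      then have "\<bar>real_of_int j\<bar> * 1 \<le> \<bar>real_of_int j\<bar> * \<bar>real_of_int j\<bar>" by (intro mult_left_mono) auto
      then show ?thesis by (simp add: power2_eq_square)
    qed simp
    then have "- c * (real_of_int j)\<^sup>2 \<le> real (nat \<bar>j\<bar>) * (- c)" using assms by simp
    then show ?thesis by (simp add: exp_of_nat_mult[symmetric])
  qed
  have geo: "(\<Sum>n\<in>{..N}. ?r ^ n) \<le> 1 / (1 - ?r)"
    using assms sum_le_suminf[of "\<lambda>n. ?r ^ n" "{..N}"] by (simp add: summable_geometric suminf_geometric)
  have "{- int N..int N} \<subseteq> int ` {..N} \<union> (\<lambda>n. - int n) ` {..N}"
  proof
    fix j assume "j \<in> {- int N..int N}"
    then show "j \<in> int ` {..N} \<union> (\<lambda>n. - int n) ` {..N}"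
      by (cases "0 \<le> j") (auto simp: image_iff intro: bexI[of _ "nat j"] bexI[of _ "nat (- j)"])
  qed
  then have "(\<Sum>j\<in>{- int N..int N}. exp (- c * (real_of_int j)\<^sup>2)) \<le> (\<Sum>j\<in>int ` {..N} \<union> (\<lambda>n. - int n) ` {..N}. ?r ^ nat \<bar>j\<bar>)"
    by (intro order_trans[OF sum_mono[OF term_le] sum_mono2]) auto
  also have "\<dots> \<le> (\<Sum>j\<in>int ` {..N}. ?r ^ nat \<bar>j\<bar>) + (\<Sum>j\<in>(\<lambda>n. - int n) ` {..N}. ?r ^ nat \<bar>j\<bar>)"
    by (subst sum.union_inter[symmetric]) (auto intro!: sum_nonneg)
  also have "\<dots> = 2 * (\<Sum>n\<in>{..N}. ?r ^ n)"
    by (subst sum.reindex, force simp: inj_on_def, subst sum.reindex, force simp: inj_on_def) simp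
  also have "\<dots> \<le> 2 / (1 - ?r)" using geo by simp
  finally show ?thesis .
qed

text \<open>A finite set of lattice points lies in a box of integer points, over which the Gaussian
  sum factors into one-dimensional sums bounded independently of the size \<open>N\<close> of the
  box.\<close>

lemma summable_gaussian_lattice:
  fixes c :: real
  assumes c: "0 < c"
  shows "(\<lambda>k::real^'d. exp (- c * (norm k)\<^sup>2)) summable_on lattice"
proof (rule nonneg_bdd_above_summable_on)
  show "bdd_above (sum (\<lambda>k::real^'d. exp (- c * (norm k)\<^sup>2)) ` {F. F \<subseteq> lattice \<and> finite F})"
  proof (rule bdd_aboveI2)
    fix F :: "(real^'d) set" assume F: "F \<in> {F. F \<subseteq> lattice \<and> finite F}"
    obtain B where B: "\<And>k. k \<in> F \<Longrightarrow> norm k \<le> B"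
      using F finite_imp_bounded[of F] by (auto simp: bounded_iff)
    obtain N :: nat where N: "B \<le> real N" using real_arch_simple by blast
    define v :: "('d \<Rightarrow> int) \<Rightarrow> real^'d" where "v g = (\<chi> i. of_int (g i))" for g
    let ?G = "PiE (UNIV::'d set) (\<lambda>_. {- int N..int N})"
    have inj: "inj_on v ?G" by (auto simp: inj_on_def v_def vec_eq_iff)
    have "F \<subseteq> v ` ?G"
    proof
      fix k assume k: "k \<in> F"
      have fl: "of_int \<lfloor>k $ i\<rfloor> = k $ i" for i
      proof -
        have "k $ i \<in> \<int>" using k F by (auto simp: lattice_def)
        then show ?thesis by (rule Ints_cases) simp
      qed
      have "\<lfloor>k $ i\<rfloor> \<in> {- int N..int N}" for i
      proof -
        have "\<bar>k $ i\<bar> \<le> real N" using component_le_norm_cart[of k i] B[OF k] N by linarith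
        then have "- real N \<le> of_int \<lfloor>k $ i\<rfloor>" "of_int \<lfloor>k $ i\<rfloor> \<le> real N"
          unfolding fl by linarith+
        then show ?thesis by (metis atLeastAtMost_iff of_int_le_iff of_int_minus of_int_of_nat_eq)
      qed
      then have "(\<lambda>i. \<lfloor>k $ i\<rfloor>) \<in> ?G" by auto
      moreover have "v (\<lambda>i. \<lfloor>k $ i\<rfloor>) = k" by (simp add: v_def fl vec_eq_iff)
      ultimately show "k \<in> v ` ?G" by (metis imageI)
    qed
    moreover have fin: "finite ?G" by (intro finite_PiE) auto
    ultimately have "(\<Sum>k\<in>F. exp (- c * (norm k)\<^sup>2)) \<le> (\<Sum>k\<in>v ` ?G. exp (- c * (norm k)\<^sup>2))"
      by (intro sum_mono2) auto
    also have "\<dots> = (\<Sum>g\<in>?G. exp (- c * (norm (v g))\<^sup>2))"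
      by (simp add: sum.reindex[OF inj])
    also have "\<dots> = (\<Sum>g\<in>?G. \<Prod>i\<in>UNIV. exp (- c * (of_int (g i))\<^sup>2))"
    proof (rule sum.cong)
      fix g :: "'d \<Rightarrow> int"
      have "(norm (v g))\<^sup>2 = (\<Sum>i\<in>UNIV. (of_int (g i))\<^sup>2)"
        unfolding power2_norm_eq_inner inner_vec_def by (simp add: v_def power2_eq_square)
      then show "exp (- c * (norm (v g))\<^sup>2) = (\<Prod>i\<in>UNIV. exp (- c * (of_int (g i))\<^sup>2))"
        by (simp only: sum_distrib_left exp_sum finite)
    qed simp
    also have "\<dots> = (\<Prod>i\<in>(UNIV::'d set). \<Sum>j\<in>{- int N..int N}. exp (- c * (of_int j)\<^sup>2))"
      by (rule prod_sum_PiE[symmetric]) auto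
    also have "\<dots> \<le> (\<Prod>i\<in>(UNIV::'d set). 2 / (1 - exp (- c)))"
      using sum_exp_abs_le[OF c] by (intro prod_mono) (auto intro!: sum_nonneg)
    finally show "(\<Sum>k\<in>F. exp (- c * (norm k)\<^sup>2)) \<le> (\<Prod>i\<in>(UNIV::'d set). 2 / (1 - exp (- c)))" .
  qed
qed auto

text \<open>The periodized Gaussian, that is, \<open>heat_kernel\<close> without its normalizing
  prefactor.\<close>

definition theta :: "real \<Rightarrow> real^'d \<Rightarrow> real" where
  "theta eps x = (\<Sum>\<^sub>\<infinity>k\<in>lattice. exp (- (norm (x - (2*pi) *\<^sub>R k))\<^sup>2 / (2 * eps)))"

text \<open>A summable majorant valid for all \<open>x\<close> in a ball at once, from
  \<open>|2 pi k|^2 <= 2 |x|^2 + 2 |x - 2 pi k|^2\<close>.\<close>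

lemma gaussian_shift_le:
  fixes x k :: "real^'d"
  assumes eps: "0 < eps" and x: "norm x \<le> r"
  shows "exp (- (norm (x - (2*pi) *\<^sub>R k))\<^sup>2 / (2 * eps)) \<le> exp (r\<^sup>2 / (2 * eps)) * exp (- (pi\<^sup>2 / eps) * (norm k)\<^sup>2)"
proof -
  let ?w = "(2*pi) *\<^sub>R k"
  have "(norm ?w)\<^sup>2 \<le> (norm x + norm (x - ?w))\<^sup>2"
    using norm_triangle_ineq4[of x "x - ?w"] by (intro power_mono) auto
  also have "\<dots> \<le> 2 * (norm x)\<^sup>2 + 2 * (norm (x - ?w))\<^sup>2"
    using sum_squares_bound[of "norm x" "norm (x - ?w)"] by (simp add: power2_sum)
  also have "(norm x)\<^sup>2 \<le> r\<^sup>2" using x by (intro power_mono) auto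
  finally have "4 * pi\<^sup>2 * (norm k)\<^sup>2 \<le> 2 * r\<^sup>2 + 2 * (norm (x - ?w))\<^sup>2"
    by (simp add: power_mult_distrib)
  then have "- (norm (x - ?w))\<^sup>2 / (2 * eps) \<le> r\<^sup>2 / (2 * eps) + - (pi\<^sup>2 / eps) * (norm k)\<^sup>2"
    using eps by (simp add: field_simps)
  then show ?thesis by (simp add: exp_add[symmetric])
qed

lemma theta_summable:
  fixes x :: "real^'d"
  assumes eps: "0 < eps"
  shows "(\<lambda>k. exp (- (norm (x - (2*pi) *\<^sub>R k))\<^sup>2 / (2 * eps))) summable_on lattice"
proof (rule summable_on_comparison_test)
  show "(\<lambda>k::real^'d. exp ((norm x)\<^sup>2 / (2 * eps)) * exp (- (pi\<^sup>2 / eps) * (norm k)\<^sup>2)) summable_on lattice"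
    using eps by (intro summable_on_cmult_right summable_gaussian_lattice) auto
qed (use gaussian_shift_le[OF eps order_refl] in auto)

lemma theta_pos:
  fixes x :: "real^'d"
  assumes eps: "0 < eps"
  shows "0 < theta eps x"
proof -
  have "0 < exp (- (norm x)\<^sup>2 / (2 * eps))" by simp
  also have "\<dots> = (\<Sum>\<^sub>\<infinity>k\<in>{0::real^'d}. exp (- (norm (x - (2*pi) *\<^sub>R k))\<^sup>2 / (2 * eps)))" by simp
  also have "\<dots> \<le> theta eps x"
    unfolding theta_def by (rule infsum_mono2) (use theta_summable[OF eps] lattice_0 in auto)
  finally show ?thesis .
qed

text \<open>The Weierstrass M-test along the net of finite subsets of the lattice: on each ball the
  tail of \<open>theta\<close> is at most the tail of the majorant from
  \<open>gaussian_shift_le\<close>.\<close>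

lemma theta_continuous:
  assumes eps: "0 < eps"
  shows "continuous_on UNIV (theta eps :: real^'d \<Rightarrow> real)"
proof -
  have ball: "continuous_on (ball 0 r) (theta eps :: real^'d \<Rightarrow> real)" for r
  proof -
    let ?f = "\<lambda>(x::real^'d) k. exp (- (norm (x - (2*pi) *\<^sub>R k))\<^sup>2 / (2 * eps))"
    let ?M = "\<lambda>k::real^'d. exp (r\<^sup>2 / (2 * eps)) * exp (- (pi\<^sup>2 / eps) * (norm k)\<^sup>2)"
    have M: "?M summable_on lattice"
      using eps by (intro summable_on_cmult_right summable_gaussian_lattice) auto
    have lim: "(sum ?M \<longlongrightarrow> infsum ?M lattice) (finite_subsets_at_top lattice)"
      using has_sum_infsum[OF M] by (simp add: has_sum_def)
    have "uniform_limit (ball 0 r) (\<lambda>S x. sum (?f x) S) (theta eps) (finite_subsets_at_top lattice)"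
    proof (rule uniform_limitI)
      fix e :: real assume "0 < e"
      with lim have "\<forall>\<^sub>F S in finite_subsets_at_top lattice. dist (sum ?M S) (infsum ?M lattice) < e"
        by (rule tendstoD)
      moreover have "\<forall>\<^sub>F S in finite_subsets_at_top lattice. finite S \<and> S \<subseteq> (lattice :: (real^'d) set)"
        by (rule eventually_finite_subsets_at_top_weakI) auto
      ultimately show "\<forall>\<^sub>F S in finite_subsets_at_top lattice. \<forall>x\<in>ball 0 r. dist (sum (?f x) S) (theta eps x) < e"
      proof eventually_elim
        case (elim S)
        show ?case
        proof
          fix x :: "real^'d" assume "x \<in> ball 0 r"
          then have x: "norm x \<le> r" by simp
          have split: "infsum g lattice = sum g S + infsum g (lattice - S)" if "g summable_on lattice" for g :: "real^'d \<Rightarrow> real"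
          proof -
            have "infsum g (lattice - S) = infsum g lattice - infsum g S"
              using that elim by (intro infsum_Diff) auto
            then show ?thesis using elim by simp
          qed
          have "infsum (?f x) (lattice - S) \<le> infsum ?M (lattice - S)"
            using theta_summable[OF eps, of x] M gaussian_shift_le[OF eps x]
            by (intro infsum_mono) (auto intro: summable_on_subset_banach)
          moreover have "0 \<le> infsum (?f x) (lattice - S)" by (rule infsum_nonneg) simp
          moreover have "0 \<le> infsum ?M (lattice - S)" by (rule infsum_nonneg) simp
          ultimately show "dist (sum (?f x) S) (theta eps x) < e"
            using elim split[OF M] split[OF theta_summable[OF eps, of x]]
            by (simp add: dist_real_def theta_def)
        qed
      qed
    qed
    then show ?thesis
      by (rule uniform_limit_theorem[rotated]) (use eps in \<open>auto intro!: always_eventually continuous_intros\<close>)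
  qed
  show ?thesis
  proof (rule continuous_at_imp_continuous_on, rule ballI)
    fix x :: "real^'d"
    show "isCont (theta eps) x"
      using ball[of "norm x + 1"] by (rule continuous_on_interior) simp
  qed
qed

lemma theta_periodic:
  fixes x :: "real^'d"
  assumes l: "l \<in> lattice"
  shows "theta eps (x + (2*pi) *\<^sub>R l) = theta eps x"
  unfolding theta_def
  by (rule infsum_reindex_bij_witness[of _ "\<lambda>k. k + l" "\<lambda>k. k - l"])
     (use l in \<open>auto simp: lattice_add lattice_diff algebra_simps\<close>)

lemma theta_even:
  fixes x :: "real^'d"
  shows "theta eps (- x) = theta eps x"
  unfolding theta_def
proof (rule infsum_reindex_bij_witness[of _ uminus uminus])
  fix k :: "real^'d"
  have "norm (x - (2*pi) *\<^sub>R (- k)) = norm (- (- x - (2*pi) *\<^sub>R k))" by (simp add: algebra_simps)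
  then show "exp (- (norm (x - (2*pi) *\<^sub>R (- k)))\<^sup>2 / (2 * eps)) = exp (- (norm (- x - (2*pi) *\<^sub>R k))\<^sup>2 / (2 * eps))"
    by (simp only: norm_minus_cancel)
qed (auto simp: lattice_uminus)

section \<open>Log-convexity of the heat kernel\<close>

text \<open>With its converse \<open>square_le_of_AM_GM\<close> this linearizes
  \<open>c^2 <= a * b\<close>. For fixed \<open>l\<close> the linear form can be summed or
  integrated, so pointwise midpoint log-convexity passes to sums and integrals.\<close>

lemma AM_GM_weighted:
  fixes a b c l :: real
  assumes "0 \<le> a" "0 \<le> b" "c\<^sup>2 \<le> a * b" "0 < l"
  shows "2 * c \<le> l * a + b / l"
proof -
  have "(2 * c)\<^sup>2 \<le> 4 * (l * a) * (b / l)" using assms by simp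
  also have "\<dots> \<le> (l * a + b / l)\<^sup>2"
    using zero_le_power2[of "l * a - b / l"] assms(4) unfolding power2_sum power2_diff by simp
  finally show ?thesis using assms by (meson power2_le_imp_le add_nonneg_nonneg divide_nonneg_pos less_imp_le mult_nonneg_nonneg)
qed

text \<open>The optimal weight \<open>l = sqrt (B / A)\<close> makes both terms equal to
  \<open>sqrt (A * B)\<close>.\<close>

lemma square_le_of_AM_GM:
  fixes A B C :: real
  assumes "0 < A" "0 < B" "0 \<le> C" and le: "\<And>l. 0 < l \<Longrightarrow> 2 * C \<le> l * A + B / l"
  shows "C\<^sup>2 \<le> A * B"
proof -
  define l where "l = sqrt (B / A)"
  have "0 < l" using assms by (simp add: l_def)
  have "l * A = sqrt (A * B)" "B / l = sqrt (A * B)"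
    using assms by (auto simp: l_def real_sqrt_mult real_sqrt_divide field_simps)
  then have "C \<le> sqrt (A * B)" using le[OF \<open>0 < l\<close>] by simp
  then have "C\<^sup>2 \<le> (sqrt (A * B))\<^sup>2" using assms by (intro power_mono) auto
  then show ?thesis using assms by simp
qed

text \<open>Each summand of \<open>theta eps (x - y) * exp (|y|\<^sup>2 / (2 eps))\<close> is the exponential of an affine
  function of \<open>y\<close>, so the sum is log-convex in \<open>y\<close>.\<close>

lemma theta_log_convex:
  fixes x y z :: "real^'d"
  assumes eps: "0 < eps"
  defines "T \<equiv> \<lambda>y. theta eps (x - y) * exp ((norm y)\<^sup>2 / (2 * eps))"
  shows "(T ((y + z) /\<^sub>R 2))\<^sup>2 \<le> T y * T z"
proof -
  define e where "e y k = exp (- (norm (x - y - (2*pi) *\<^sub>R k))\<^sup>2 / (2 * eps)) * exp ((norm y)\<^sup>2 / (2 * eps))" for y k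
  have T: "T y = infsum (e y) lattice" and summable: "e y summable_on lattice" for y
    unfolding T_def theta_def e_def
    by (rule infsum_cmult_left[symmetric] summable_on_cmult_left theta_summable[OF eps])+
  have pos: "0 < T y" for y unfolding T_def by (intro mult_pos_pos theta_pos[OF eps]) simp
  \<comment> \<open>The squares of \<open>norm y\<close> cancel, leaving an exponent affine in
    \<open>y\<close>.\<close>
  have e: "e y k = exp ((2 * ((x - (2*pi) *\<^sub>R k) \<bullet> y) - (norm (x - (2*pi) *\<^sub>R k))\<^sup>2) / (2 * eps))" for y k
    unfolding e_def exp_add[symmetric] add_divide_distrib[symmetric]
    by (simp add: power2_norm_eq_inner inner_diff_left inner_diff_right inner_commute algebra_simps)
  have mid: "(e ((y + z) /\<^sub>R 2) k)\<^sup>2 = e y k * e z k" for k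
    unfolding e power2_eq_square exp_add[symmetric] add_divide_distrib[symmetric]
    by (simp add: inner_add_right)
  show ?thesis
  proof (rule square_le_of_AM_GM[OF pos pos less_imp_le[OF pos]])
    fix l :: real assume l: "0 < l"
    have "2 * T ((y + z) /\<^sub>R 2) = infsum (\<lambda>k. 2 * e ((y + z) /\<^sub>R 2) k) lattice"
      by (simp add: T infsum_cmult_right')
    also have "\<dots> \<le> infsum (\<lambda>k. l * e y k + e z k / l) lattice"
      using l mid unfolding divide_inverse
      by (intro infsum_mono summable_on_add summable_on_cmult_right summable_on_cmult_left summable)
         (auto simp: divide_inverse[symmetric] e_def intro!: AM_GM_weighted)
    also have "\<dots> = l * T y + T z / l"
      unfolding T divide_inverse
      by (subst infsum_add) (auto simp: infsum_cmult_right' infsum_cmult_left' intro!: summable_on_cmult_right summable_on_cmult_left summable)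
    finally show "2 * T ((y + z) /\<^sub>R 2) \<le> l * T y + T z / l" .
  qed
qed

lemma heat_kernel_eq: "heat_kernel eps (x::real^'d) = (2 * pi * eps) powr (- real CARD('d) / 2) * theta eps x"
  by (simp add: heat_kernel_def theta_def)

lemma heat_kernel_pos: "0 < eps \<Longrightarrow> 0 < heat_kernel eps x"
  by (simp add: heat_kernel_eq theta_pos)

lemma heat_kernel_even: "heat_kernel eps (- x) = heat_kernel eps x"
  by (simp add: heat_kernel_eq theta_even)

lemma heat_kernel_tcont: "0 < eps \<Longrightarrow> tcont (heat_kernel eps)"
  unfolding tcont_def tper_def heat_kernel_eq
  by (auto intro!: continuous_intros theta_continuous simp: theta_periodic)

lemma heat_kernel_log_convex:
  fixes x y z :: "real^'d"
  assumes eps: "0 < eps"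
  defines "T \<equiv> \<lambda>y. heat_kernel eps (x - y) * exp ((norm y)\<^sup>2 / (2 * eps))"
  shows "(T ((y + z) /\<^sub>R 2))\<^sup>2 \<le> T y * T z"
proof -
  let ?c = "(2 * pi * eps) powr (- real CARD('d) / 2)"
  have "?c\<^sup>2 * (theta eps (x - (y + z) /\<^sub>R 2) * exp ((norm ((y + z) /\<^sub>R 2))\<^sup>2 / (2 * eps)))\<^sup>2 \<le>
    ?c\<^sup>2 * ((theta eps (x - y) * exp ((norm y)\<^sup>2 / (2 * eps))) * (theta eps (x - z) * exp ((norm z)\<^sup>2 / (2 * eps))))"
    by (intro mult_left_mono theta_log_convex[OF eps]) auto
  then show ?thesis
    unfolding T_def heat_kernel_eq by (simp only: power_mult_distrib power2_eq_square ac_simps)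
qed

lemma exp_ecost: "0 < eps \<Longrightarrow> exp (- ecost eps x y / eps) = heat_kernel eps (x - y)"
  by (simp add: ecost_def heat_kernel_pos)

lemma ecost_commute: "ecost eps x y = ecost eps y x"
  using heat_kernel_even[of eps "x - y"] by (simp add: ecost_def)

section \<open>The dual functional\<close>

text \<open>Turns \<open>tint\<close> into an integral over a finite measure, the form in which the
  tilting locales are stated.\<close>

definition torus :: "(real^'d) measure" where
  "torus = restrict_space lborel cube"

lemma tint_torus: "tint f = (\<integral>x. f x \<partial>torus)"
  unfolding tint_def set_lebesgue_integral_def torus_def by (simp add: integral_restrict_space)

lemma space_torus [simp]: "space torus = cube"
  by (simp add: torus_def space_restrict_space)

lemma finite_measure_torus: "finite_measure (torus :: (real^'d) measure)"
proof
  have "emeasure lborel (cube :: (real^'d) set) < \<infinity>"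
    using emeasure_compact_finite[OF compact_cube] by simp
  then show "emeasure torus (space torus :: (real^'d) set) \<noteq> \<infinity>"
    by (simp add: torus_def emeasure_restrict_space space_restrict_space)
qed

interpretation torus: finite_measure "torus :: (real^'d) measure"
  by (rule finite_measure_torus)

interpretation torus_pair: pair_sigma_finite "torus :: (real^'d) measure" "torus :: (real^'d) measure" ..

lemma measurable_torus: "f \<in> borel_measurable borel \<Longrightarrow> f \<in> borel_measurable torus"
  unfolding torus_def by (rule measurable_restrict_space1) simp

lemma measurable_id_torus [measurable]: "(\<lambda>x. x) \<in> borel_measurable torus"
  by (rule measurable_torus) simp

lemma measurable_fst_torus [measurable]: "fst \<in> borel_measurable (torus \<Otimes>\<^sub>M M)"
  using measurable_compose[OF measurable_fst measurable_id_torus] by simp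

lemma measurable_snd_torus [measurable]: "snd \<in> borel_measurable (M \<Otimes>\<^sub>M torus)"
  using measurable_compose[OF measurable_snd measurable_id_torus] by simp

lemma torus_integrable:
  fixes f :: "real^'d \<Rightarrow> real"
  assumes "f \<in> borel_measurable borel" "\<And>x. \<bar>f x\<bar> \<le> B"
  shows "integrable torus f"
  using assms by (intro torus.integrable_const_bound[where B=B]) (auto intro: measurable_torus)

lemma tcont_measurable: "tcont f \<Longrightarrow> f \<in> borel_measurable borel"
  by (auto simp: tcont_def intro: borel_measurable_continuous_onI)

lemma bounded_density_integrable:
  assumes "bounded_density m lo hi" "0 < lo" "f \<in> borel_measurable borel" "\<And>x. \<bar>f x\<bar> \<le> B"
  shows "integrable torus (\<lambda>x. f x * m x)"
proof (rule torus_integrable[where B="B * hi"])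
  fix x
  have "lo \<le> m x" "m x \<le> hi" using assms(1) by (auto simp: bounded_density_def)
  then have "\<bar>m x\<bar> \<le> hi" using assms(2) by linarith
  moreover have "0 \<le> B" using assms(4)[of x] by linarith
  ultimately show "\<bar>f x * m x\<bar> \<le> B * hi"
    unfolding abs_mult using assms(4)[of x] by (intro mult_mono) auto
qed (use assms in \<open>auto simp: bounded_density_def\<close>)

lemma bounded_density_integral_ge:
  assumes "bounded_density m lo hi" "0 < lo" "f \<in> borel_measurable borel" "\<And>x. \<bar>f x\<bar> \<le> B" "\<And>x. c \<le> f x"
  shows "c \<le> (\<integral>x. f x * m x \<partial>torus)"
proof -
  have "(\<integral>x. c * m x \<partial>torus) \<le> (\<integral>x. f x * m x \<partial>torus)"
  proof (rule integral_mono)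
    show "integrable torus (\<lambda>x. c * m x)"
      by (rule bounded_density_integrable[OF assms(1,2), of "\<lambda>_. c" "\<bar>c\<bar>"]) auto
    fix x
    have "lo \<le> m x" using assms(1) by (auto simp: bounded_density_def)
    then show "c * m x \<le> f x * m x" using assms(2,5) by (intro mult_right_mono) auto
  qed (rule bounded_density_integrable[OF assms(1-4)])
  moreover have "(\<integral>x. m x \<partial>torus) = 1" using assms(1) by (simp add: bounded_density_def tint_torus)
  ultimately show ?thesis by simp
qed

text \<open>The cost is symmetric because the heat kernel is even. Hence the whole problem is
  invariant under exchanging the two marginals.\<close>

lemma cT_nu_eq_cT_mu: "cT_nu eps m f = cT_mu eps m f"
proof
  fix x
  show "cT_nu eps m f x = cT_mu eps m f x"
    unfolding cT_nu_def cT_mu_def by (simp only: ecost_commute[of eps x])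
qed

lemma heat_kernel_bounds:
  assumes "0 < eps"
  obtains lo hi where "0 < lo" "\<And>x::real^'d. lo \<le> heat_kernel eps x \<and> heat_kernel eps x \<le> hi"
proof -
  have H: "tcont (heat_kernel eps :: real^'d \<Rightarrow> real)" by (rule heat_kernel_tcont[OF assms])
  from tcont_attains_inf[OF H]
  obtain z :: "real^'d" where z: "\<forall>x::real^'d. heat_kernel eps z \<le> heat_kernel eps x" ..
  obtain B where B: "\<And>x. \<bar>(heat_kernel eps :: real^'d \<Rightarrow> real) x\<bar> \<le> B"
    by (rule tcont_bounded[OF H]) (rule that)
  show ?thesis
  proof (rule that[of "heat_kernel eps z" B])
    show "0 < heat_kernel eps z" by (rule heat_kernel_pos[OF assms])
    show "heat_kernel eps z \<le> heat_kernel eps x \<and> heat_kernel eps x \<le> B" for x :: "real^'d"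
      using z[rule_format, of x] B[of x] by linarith
  qed
qed

lemma exp_minus_ecost:
  assumes "0 < eps"
  shows "exp ((u - ecost eps x y) / eps) = exp (u / eps) * heat_kernel eps (x - y)"
proof -
  have "(u - ecost eps x y) / eps = u / eps + - ecost eps x y / eps" by (simp add: diff_divide_distrib)
  then show ?thesis by (simp only: exp_add exp_ecost[OF assms])
qed

lemma heat_kernel_measurable: "0 < eps \<Longrightarrow> heat_kernel eps \<in> borel_measurable borel"
  by (rule tcont_measurable[OF heat_kernel_tcont])

text \<open>\<open>exp (cT_mu eps m f y / eps)\<close> is the reciprocal of the integral
  \<open>I\<close>. The lower bounds on \<open>f\<close>, the kernel and \<open>m\<close> make
  \<open>I\<close> positive, so the logarithm in \<open>cT_mu\<close> is a genuine one.\<close>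

lemma cT_mu_normalized:
  fixes f m :: "real^'d \<Rightarrow> real"
  assumes eps: "0 < eps" and f: "tcont f" and m: "bounded_density m lo hi" "0 < lo"
  shows "(\<integral>x. exp (f x / eps) * exp (cT_mu eps m f y / eps) * heat_kernel eps (x - y) * m x \<partial>torus) = 1"
proof -
  note [measurable] = heat_kernel_measurable[OF eps] tcont_measurable[OF f]
  obtain B where B: "\<And>x. \<bar>f x\<bar> \<le> B" using tcont_bounded[OF f] by blast
  obtain l h where l: "0 < l" and h: "\<And>x::real^'d. l \<le> heat_kernel eps x \<and> heat_kernel eps x \<le> h"
    using heat_kernel_bounds[OF eps] by blast
  define I where "I = (\<integral>x. exp (f x / eps) * heat_kernel eps (x - y) * m x \<partial>torus)"
  have e: "exp (- (B / eps)) \<le> exp (f x / eps)" "exp (f x / eps) \<le> exp (B / eps)" for x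
    using B[of x] eps by (auto simp: abs_le_iff field_simps)
  have "exp (- (B / eps)) * l \<le> I"
    unfolding I_def
  proof (rule bounded_density_integral_ge[OF m, where B="exp (B / eps) * h"])
    fix x
    show "exp (- (B / eps)) * l \<le> exp (f x / eps) * heat_kernel eps (x - y)"
      using e h l by (intro mult_mono) auto
    have "0 \<le> heat_kernel eps (x - y)" using h[of "x - y"] l by linarith
    then show "\<bar>exp (f x / eps) * heat_kernel eps (x - y)\<bar> \<le> exp (B / eps) * h"
      using e h by (auto simp: abs_mult intro!: mult_mono)
  qed measurable
  moreover have "0 < exp (- (B / eps)) * l" using l by simp
  ultimately have I: "0 < I" by linarith
  have "cT_mu eps m f y = - eps * ln I"
    unfolding cT_mu_def I_def tint_torus exp_minus_ecost[OF eps] ..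
  then have "exp (cT_mu eps m f y / eps) * I = 1" using I eps by (simp add: exp_minus)
  moreover have "(\<integral>x. exp (f x / eps) * exp (cT_mu eps m f y / eps) * heat_kernel eps (x - y) * m x \<partial>torus)
    = exp (cT_mu eps m f y / eps) * I"
  proof -
    have "(\<integral>x. exp (f x / eps) * exp (cT_mu eps m f y / eps) * heat_kernel eps (x - y) * m x \<partial>torus)
      = (\<integral>x. exp (cT_mu eps m f y / eps) * (exp (f x / eps) * heat_kernel eps (x - y) * m x) \<partial>torus)"
      by (rule Bochner_Integration.integral_cong) (simp_all only: ac_simps)
    then show ?thesis unfolding I_def by (simp only: integral_mult_right_zero)
  qed
  ultimately show ?thesis by simp
qed

section \<open>Schroedinger potentials and a perturbation \<open>chi\<close>\<close>

text \<open>Both fixed-point equations are written with \<open>cT_mu\<close>, so that exchanging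
  \<open>mu\<close> with \<open>nu\<close> and \<open>phi\<close> with \<open>psi\<close> gives
  another instance.\<close>

locale schrodinger =
  fixes eps :: real and mu nu phi psi chi :: "real^'d \<Rightarrow> real" and mmu Mmu mnu Mnu :: real
  assumes eps: "0 < eps"
    and mu: "bounded_density mu mmu Mmu" "0 < mmu"
    and nu: "bounded_density nu mnu Mnu" "0 < mnu"
    and phi: "tcont phi" and psi: "tcont psi" and chi: "tcont chi"
    and phi_eq: "phi = cT_mu eps nu psi" and psi_eq: "psi = cT_mu eps mu phi"
begin

abbreviation "H \<equiv> heat_kernel eps :: real^'d \<Rightarrow> real"

lemma measurable_mu [measurable]: "mu \<in> borel_measurable borel"
  and measurable_nu [measurable]: "nu \<in> borel_measurable borel"
  using mu nu by (auto simp: bounded_density_def)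

lemmas [measurable] = heat_kernel_measurable[OF eps] tcont_measurable[OF phi] tcont_measurable[OF psi] tcont_measurable[OF chi]

lemma mu_bounds: "0 < mu x" "mu x \<le> Mmu"
proof -
  have "mmu \<le> mu x" "mu x \<le> Mmu" using mu by (auto simp: bounded_density_def)
  then show "0 < mu x" "mu x \<le> Mmu" using mu(2) by linarith+
qed

lemma nu_bounds: "mnu \<le> nu x" "nu x \<le> Mnu" "0 < nu x"
proof -
  show *: "mnu \<le> nu x" "nu x \<le> Mnu" using nu by (auto simp: bounded_density_def)
  show "0 < nu x" using nu(2) * by linarith
qed

lemma mu_int: "(\<integral>x. mu x \<partial>torus) = 1" and nu_int: "(\<integral>x. nu x \<partial>torus) = 1"
  using mu nu by (auto simp: bounded_density_def tint_torus)

lemma H_pos: "0 < H x"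
  by (rule heat_kernel_pos[OF eps])

text \<open>The density of the Schroedinger plan with respect to the product of \<open>mu\<close>
  and \<open>nu\<close>.\<close>

definition k :: "real^'d \<Rightarrow> real^'d \<Rightarrow> real" where
  "k x y = exp (phi x / eps) * exp (psi y / eps) * H (x - y)"

definition X :: "real^'d \<Rightarrow> real" where "X x = (chi x - (INF z. chi z)) / eps"

definition s :: real where "s = osc chi / eps"

text \<open>\<open>- eps * ln (G t y)\<close> is the transform of \<open>phi + t * chi\<close> at
  \<open>y\<close>, up to the additive constant \<open>t * inf chi\<close>.\<close>

definition G :: "real \<Rightarrow> real^'d \<Rightarrow> real" where
  "G t y = (\<integral>x. exp (phi x / eps + t * X x) * H (x - y) * mu x \<partial>torus)"

text \<open>The Gaussian factor compensates the semiconcavity of the transform: \<open>U\<close> is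
  jointly midpoint log-convex in \<open>(t, y)\<close>.\<close>

definition U :: "real \<Rightarrow> real^'d \<Rightarrow> real" where
  "U t y = G t y * exp ((norm y)\<^sup>2 / (2 * eps))"

lemma X_bounds: "0 \<le> X x" "X x \<le> s"
  using tcont_osc[OF chi, of x] eps by (auto simp: X_def s_def divide_right_mono)

lemma measurable_X [measurable]: "X \<in> borel_measurable borel"
  unfolding X_def[abs_def] by measurable

lemma k_pos: "0 < k x y"
  by (simp add: k_def H_pos)

lemma k_bounded: obtains B where "\<And>x y. k x y \<le> B"
proof -
  obtain B where B: "\<And>x. \<bar>phi x\<bar> \<le> B" using tcont_bounded[OF phi] by blast
  obtain B' where B': "\<And>x. \<bar>psi x\<bar> \<le> B'" using tcont_bounded[OF psi] by blast
  obtain l h where l: "0 < l" and h: "\<And>x. l \<le> H x \<and> H x \<le> h"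
    using heat_kernel_bounds[OF eps] by blast
  have "k x y \<le> exp (B / eps) * exp (B' / eps) * h" for x y
    unfolding k_def using B[of x] B'[of y] h eps H_pos[of "x - y"]
    by (intro mult_mono) (auto simp: abs_le_iff divide_right_mono)
  then show ?thesis by (rule that)
qed

lemma k_marginal_x: "(\<integral>x. k x y * mu x \<partial>torus) = 1"
  using cT_mu_normalized[OF eps phi mu, of y] unfolding k_def psi_eq[symmetric] .

text \<open>Same normalization with the marginals exchanged, by \<open>phi_eq\<close> and the
  evenness of the kernel.\<close>

lemma k_marginal_y: "(\<integral>y. k x y * nu y \<partial>torus) = 1"
proof -
  have "k x y * nu y = exp (psi y / eps) * exp (cT_mu eps nu psi x / eps) * H (y - x) * nu y" for y
    using heat_kernel_even[of eps "x - y"] unfolding phi_eq[symmetric] k_def by simp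
  then show ?thesis
    using cT_mu_normalized[OF eps psi nu, of x] by (simp only:)
qed

lemma integrand_G_bounds:
  "\<exists>l h. 0 < l \<and> (\<forall>x y. l \<le> exp (phi x / eps + t * X x) * H (x - y) \<and>
    exp (phi x / eps + t * X x) * H (x - y) \<le> h)"
proof -
  obtain B where B: "\<And>x. \<bar>phi x\<bar> \<le> B" using tcont_bounded[OF phi] by blast
  obtain l h where l: "0 < l" and h: "\<And>x. l \<le> H x \<and> H x \<le> h"
    using heat_kernel_bounds[OF eps] by blast
  have e: "\<bar>phi x / eps + t * X x\<bar> \<le> B / eps + \<bar>t\<bar> * s" for x
  proof -
    have "\<bar>phi x / eps\<bar> \<le> B / eps" using B[of x] eps by (simp add: divide_right_mono)
    moreover have "\<bar>t * X x\<bar> \<le> \<bar>t\<bar> * s" using X_bounds[of x] by (simp add: abs_mult mult_left_mono)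
    ultimately show ?thesis by linarith
  qed
  show ?thesis
  proof (intro exI conjI allI)
    fix x y
    show "exp (- (B / eps + \<bar>t\<bar> * s)) * l \<le> exp (phi x / eps + t * X x) * H (x - y)"
      using e[of x] h[of "x - y"] l by (intro mult_mono) (auto simp: abs_le_iff)
    show "exp (phi x / eps + t * X x) * H (x - y) \<le> exp (B / eps + \<bar>t\<bar> * s) * h"
      using e[of x] h[of "x - y"] l by (intro mult_mono) (auto simp: abs_le_iff)
  qed (use l in simp)
qed

lemma integrable_G: "integrable torus (\<lambda>x. exp (phi x / eps + t * X x) * H (x - y) * mu x)"
proof -
  from integrand_G_bounds[of t] obtain l h where
    lh: "\<forall>x y. l \<le> exp (phi x / eps + t * X x) * H (x - y) \<and> exp (phi x / eps + t * X x) * H (x - y) \<le> h"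
    by (elim exE conjE)
  show ?thesis
  proof (rule bounded_density_integrable[OF mu, where B=h])
    show "\<bar>exp (phi x / eps + t * X x) * H (x - y)\<bar> \<le> h" for x
      using lh[rule_format, of x y] H_pos[of "x - y"] by (simp only: abs_mult abs_of_pos abs_exp_cancel)
  qed measurable
qed

lemma G_bounds: "\<exists>l h. 0 < l \<and> (\<forall>y. l \<le> G t y \<and> G t y \<le> h)"
proof -
  from integrand_G_bounds[of t] obtain l h where l: "0 < l"
    and lh: "\<forall>x y. l \<le> exp (phi x / eps + t * X x) * H (x - y) \<and> exp (phi x / eps + t * X x) * H (x - y) \<le> h"
    by (elim exE conjE)
  have G_ge: "l \<le> G t y" for y
    unfolding G_def
  proof (rule bounded_density_integral_ge[OF mu, where B=h])
    show "\<bar>exp (phi x / eps + t * X x) * H (x - y)\<bar> \<le> h" for x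
      using lh[rule_format, of x y] H_pos[of "x - y"] by (simp only: abs_mult abs_of_pos abs_exp_cancel)
    show "l \<le> exp (phi x / eps + t * X x) * H (x - y)" for x using lh[rule_format, of x y] by (rule conjunct1)
  qed measurable
  have G_le: "G t y \<le> h" for y
  proof -
    have "G t y \<le> (\<integral>x. h * mu x \<partial>torus)"
      unfolding G_def
    proof (rule integral_mono[OF integrable_G])
      show "integrable torus (\<lambda>x. h * mu x)"
        by (rule bounded_density_integrable[OF mu, of "\<lambda>_. h" "\<bar>h\<bar>"]) auto
      show "exp (phi x / eps + t * X x) * H (x - y) * mu x \<le> h * mu x" for x
        by (rule mult_right_mono[OF conjunct2[OF lh[rule_format, of x y]] less_imp_le[OF mu_bounds(1)]])
    qed
    then show ?thesis by (simp add: mu_int)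
  qed
  show ?thesis by (intro exI[of _ l] exI[of _ h] conjI allI l G_ge G_le)
qed

lemma G_pos: "0 < G t y"
proof -
  from G_bounds[of t] obtain l h where "0 < l" and lh: "\<forall>y. l \<le> G t y \<and> G t y \<le> h" by (elim exE conjE)
  then show ?thesis using lh[rule_format, of y] by linarith
qed

lemma U_pos: "0 < U t y"
  by (simp add: U_def G_pos)

lemma measurable_G [measurable]: "G t \<in> borel_measurable borel"
  unfolding G_def[abs_def] by measurable

lemma G_periodic: "tper (G t)"
proof -
  have "H (x - (y + (2*pi) *\<^sub>R l)) = H (x - y)" if "l \<in> lattice" for x y l
  proof -
    have "x - (y + (2*pi) *\<^sub>R l) = (x - y) + (2*pi) *\<^sub>R (- l)" by (simp add: algebra_simps)
    then show ?thesis
      using heat_kernel_tcont[OF eps] lattice_uminus[OF that] unfolding tcont_def tper_def by metis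
  qed
  then show ?thesis by (simp add: tper_def G_def)
qed

text \<open>For fixed \<open>x\<close> the integrand is log-affine in \<open>t\<close> and, by
  \<open>heat_kernel_log_convex\<close>, midpoint log-convex in \<open>y\<close>; the linearized
  AM-GM carries this through the integral over \<open>x\<close>.\<close>

lemma U_midpoint: "(U ((t + t') / 2) ((y + z) /\<^sub>R 2))\<^sup>2 \<le> U t y * U t' z"
proof (rule square_le_of_AM_GM[OF U_pos U_pos less_imp_le[OF U_pos]])
  fix l :: real assume l: "0 < l"
  define f where "f t y x = exp (phi x / eps + t * X x) * H (x - y) * mu x * exp ((norm y)\<^sup>2 / (2 * eps))" for t x y
  have U: "U t y = (\<integral>x. f t y x \<partial>torus)" and int: "integrable torus (f t y)" for t y
    unfolding U_def G_def f_def[abs_def] using integrable_G by auto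
  have f_nonneg: "0 \<le> f t y x" for t y x
    unfolding f_def by (intro mult_nonneg_nonneg less_imp_le[OF H_pos] less_imp_le[OF mu_bounds(1)]) auto
  have "2 * U ((t + t') / 2) ((y + z) /\<^sub>R 2) = (\<integral>x. 2 * f ((t + t') / 2) ((y + z) /\<^sub>R 2) x \<partial>torus)"
    by (simp add: U)
  also have "\<dots> \<le> (\<integral>x. l * f t y x + f t' z x / l \<partial>torus)"
  proof (rule integral_mono)
    fix x
    let ?T = "\<lambda>y. H (x - y) * exp ((norm y)\<^sup>2 / (2 * eps))"
    have f: "f t y x = exp (phi x / eps + t * X x) * mu x * ?T y" for t y by (simp add: f_def)
    have e: "(exp (phi x / eps + (t + t') / 2 * X x))\<^sup>2 = exp (phi x / eps + t * X x) * exp (phi x / eps + t' * X x)"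
      unfolding power2_eq_square exp_add[symmetric] by (simp add: field_simps)
    have "(f ((t + t') / 2) ((y + z) /\<^sub>R 2) x)\<^sup>2
      = exp (phi x / eps + t * X x) * exp (phi x / eps + t' * X x) * (mu x)\<^sup>2 * (?T ((y + z) /\<^sub>R 2))\<^sup>2"
      unfolding f power_mult_distrib e ..
    also have "\<dots> \<le> exp (phi x / eps + t * X x) * exp (phi x / eps + t' * X x) * (mu x)\<^sup>2 * (?T y * ?T z)"
      by (intro mult_left_mono heat_kernel_log_convex[OF eps]) auto
    also have "\<dots> = f t y x * f t' z x" unfolding f power2_eq_square by (simp only: ac_simps)
    finally show "2 * f ((t + t') / 2) ((y + z) /\<^sub>R 2) x \<le> l * f t y x + f t' z x / l"
      using l f_nonneg by (intro AM_GM_weighted) auto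
  qed (use int in auto)
  also have "\<dots> = l * U t y + U t' z / l"
    using int by (simp add: U)
  finally show "2 * U ((t + t') / 2) ((y + z) /\<^sub>R 2) \<le> l * U t y + U t' z / l" .
qed

text \<open>At fixed \<open>t\<close>, \<open>U_midpoint\<close> is the semiconcavity of
  \<open>- eps * ln (G t y)\<close> with a constant independent of \<open>eps\<close> and
  \<open>t\<close>, so \<open>periodic_semiconcave_osc\<close> bounds its oscillation by the squared
  diameter of the cube.\<close>

lemma G_comparable:
  assumes "y \<in> cube" "z \<in> cube"
  shows "eps * ln (G t y) \<le> eps * ln (G t z) + 4 * pi\<^sup>2 * real CARD('d)"
proof -
  have "- eps * ln (G t z) \<le> - eps * ln (G t y) + 4 * pi\<^sup>2 * real CARD('d)"
  proof (rule periodic_semiconcave_osc)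
    show "tper (\<lambda>y. - eps * ln (G t y))" using G_periodic by (simp add: tper_def)
    from G_bounds[of t] obtain l h where lh: "\<forall>y. l \<le> G t y \<and> G t y \<le> h" by (elim exE conjE)
    show "bdd_below ((\<lambda>y. - eps * ln (G t y)) ` cube)"
    proof (rule bdd_belowI2)
      fix y
      have "ln (G t y) \<le> ln h" using lh[rule_format, of y] G_pos[of t y] by (intro ln_mono) linarith+
      then show "- eps * ln h \<le> - eps * ln (G t y)" using eps by simp
    qed
    fix m w :: "real^'d"
    have "ln ((U t m)\<^sup>2) \<le> ln (U t (m + w) * U t (m - w))"
      using U_midpoint[of t t "m + w" "m - w"] U_pos[of t m] U_pos[of t "m + w"] U_pos[of t "m - w"]
      by (intro ln_mono) (auto simp flip: scaleR_2)
    then have "2 * ln (U t m) \<le> ln (U t (m + w)) + ln (U t (m - w))"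
      using U_pos[of t m] U_pos[of t "m + w"] U_pos[of t "m - w"] by (simp add: ln_realpow ln_mult)
    then have "eps * (2 * ln (U t m)) \<le> eps * (ln (U t (m + w)) + ln (U t (m - w)))"
      using eps by (intro mult_left_mono) auto
    then have "2 * (eps * ln (U t m)) \<le> eps * ln (U t (m + w)) + eps * ln (U t (m - w))"
      by (simp add: distrib_left)
    moreover have "eps * ln (U t y) = eps * ln (G t y) + (norm y)\<^sup>2 / 2" for y
      unfolding U_def using G_pos[of t y] eps by (simp add: ln_mult distrib_left)
    ultimately have "2 * (eps * ln (G t m)) + (norm m)\<^sup>2 \<le>
        eps * ln (G t (m + w)) + eps * ln (G t (m - w)) + ((norm (m + w))\<^sup>2 + (norm (m - w))\<^sup>2) / 2"
      by (simp add: add_divide_distrib)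
    \<comment> \<open>The parallelogram identity turns the quadratic part of
      \<open>eps * ln U\<close> into the correction \<open>(norm w)^2\<close>.\<close>
    moreover have "(norm (m + w))\<^sup>2 + (norm (m - w))\<^sup>2 = 2 * (norm m)\<^sup>2 + 2 * (norm w)\<^sup>2"
      unfolding power2_norm_eq_inner by (simp add: inner_add_left inner_add_right inner_diff_left inner_diff_right)
    ultimately show "- eps * ln (G t (m + w)) + - eps * ln (G t (m - w)) - (norm w)\<^sup>2 \<le> 2 * (- eps * ln (G t m))"
      by (simp add: add_divide_distrib)
  qed fact+
  then show ?thesis by simp
qed

section \<open>The log-concave weight on the cube\<close>

text \<open>Up to the factor \<open>exp (t * inf chi)\<close>, this is the exponential of the
  transform of \<open>phi + t * chi\<close> minus \<open>|y|^2 / 2\<close>.\<close>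

definition r :: "real \<Rightarrow> real^'d \<Rightarrow> real" where
  "r t y = exp (- eps * ln (U t y))"

definition L :: "real \<Rightarrow> real" where
  "L t = (\<integral>y. r t y \<partial>torus)"

text \<open>The conditional law of the first variable given \<open>y\<close> has density
  \<open>k x y * mu x\<close>; \<open>k_marginal_x\<close> normalizes it.\<close>

lemma tilt_k:
  assumes B: "\<And>x y. k x y \<le> B"
  shows "tilt torus (\<lambda>x. k x y * mu x) X s (B * Mmu)"
proof
  show "(\<lambda>x. k x y * mu x) \<in> borel_measurable torus" "X \<in> borel_measurable torus"
    unfolding k_def by (auto intro!: measurable_torus)
  show "0 \<le> k x y * mu x \<and> k x y * mu x \<le> B * Mmu" for x
  proof
    show "0 \<le> k x y * mu x" using k_pos[of x y] mu_bounds(1)[of x] by simp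
    show "k x y * mu x \<le> B * Mmu"
      using k_pos[of x y] mu_bounds[of x] B[of x y] by (intro mult_mono) auto
  qed
  show "0 \<le> X x \<and> X x \<le> s" for x using X_bounds by blast
  show "(\<integral>x. k x y * mu x \<partial>torus) = 1" by (rule k_marginal_x)
qed

lemma log_mgf_k: "log_mgf torus (\<lambda>x. k x y * mu x) X t = psi y / eps + ln (G t y)"
proof -
  have "exp_moment torus (\<lambda>x. k x y * mu x) X 0 t
      = (\<integral>x. exp (psi y / eps) * (exp (phi x / eps + t * X x) * H (x - y) * mu x) \<partial>torus)"
    unfolding exp_moment_def k_def by (rule Bochner_Integration.integral_cong) (auto simp: exp_add)
  also have "\<dots> = exp (psi y / eps) * G t y"
    unfolding G_def by (rule integral_mult_right_zero)
  finally show ?thesis using G_pos[of t y] by (simp add: log_mgf_def ln_mult)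
qed

lemma eps_ln_U: "eps * ln (U t y) = eps * ln (G t y) + (norm y)\<^sup>2 / 2"
  unfolding U_def using G_pos[of t y] eps by (simp add: ln_mult distrib_left)

text \<open>The \<open>psi y\<close> in the weight cancels the one that \<open>log_mgf_k\<close>
  contributes. This determines the choice of \<open>w\<close> when \<open>tilt_family\<close> is
  instantiated.\<close>

lemma weight_eq_r: "exp (psi y - (norm y)\<^sup>2 / 2) * exp (- eps * log_mgf torus (\<lambda>x. k x y * mu x) X t) = r t y"
proof -
  have "psi y - (norm y)\<^sup>2 / 2 + - eps * (psi y / eps + ln (G t y)) = - eps * ln (U t y)"
    using eps eps_ln_U[of t y] by (simp add: distrib_left)
  then show ?thesis unfolding r_def log_mgf_k exp_add[symmetric] by simp
qed

lemma measurable_r [measurable]: "r t \<in> borel_measurable borel"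
  unfolding r_def[abs_def] U_def by measurable

lemma integrable_r: "integrable torus (r t)"
proof -
  from G_bounds[of t] obtain l h where l: "0 < l" and lh: "\<forall>y. l \<le> G t y \<and> G t y \<le> h" by (elim exE conjE)
  show ?thesis
  proof (rule torus_integrable[where B="exp (- eps * ln l)"])
    fix y
    have "l * 1 \<le> U t y"
      unfolding U_def using lh[rule_format, of y] l eps by (intro mult_mono) auto
    then have "ln l \<le> ln (U t y)" using l by (intro ln_mono) auto
    then show "\<bar>r t y\<bar> \<le> exp (- eps * ln l)" using eps by (simp add: r_def)
  qed measurable
qed

lemma nn_integral_r: "(\<integral>\<^sup>+y. ennreal (r t y) * indicator cube y \<partial>lborel) = ennreal (L t)"
proof -
  have "(\<integral>\<^sup>+y. ennreal (r t y) * indicator cube y \<partial>lborel) = (\<integral>\<^sup>+y. ennreal (r t y) \<partial>torus)"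
    unfolding torus_def by (rule nn_integral_restrict_space[symmetric]) simp
  also have "\<dots> = ennreal (L t)"
    unfolding L_def by (rule nn_integral_eq_integral[OF integrable_r]) (simp add: r_def)
  finally show ?thesis .
qed

text \<open>Prekopa--Leindler for \<open>r\<close> restricted to the cube. Its pointwise hypothesis
  is \<open>U_midpoint\<close> raised to the power \<open>- eps\<close>, and convexity keeps the
  midpoint in the cube.\<close>

lemma L_log_concave: "L (t + d) * L (t - d) \<le> (L t)\<^sup>2"
proof -
  have L_nonneg: "0 \<le> L t" for t unfolding L_def r_def by (rule Bochner_Integration.integral_nonneg) simp
  have "ennreal (L (t + d)) * ennreal (L (t - d)) \<le> (ennreal (L t))\<^sup>2"
    unfolding nn_integral_r[symmetric]
  proof (rule prekopa_leindler)
    fix y z :: "real^'d"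
    show "(ennreal (r (t + d) y) * indicator cube y) * (ennreal (r (t - d) z) * indicator cube z)
      \<le> (ennreal (r t ((y + z) /\<^sub>R 2)) * indicator cube ((y + z) /\<^sub>R 2))\<^sup>2"
    proof (cases "y \<in> cube \<and> z \<in> cube")
      case True
      have "(1/2) *\<^sub>R y + (1/2) *\<^sub>R z \<in> cube"
        using True convexD[OF convex_cube, of y z "1/2" "1/2"] by simp
      then have mid: "(y + z) /\<^sub>R 2 \<in> cube" by (simp add: scaleR_add_right)
      have "(U t ((y + z) /\<^sub>R 2))\<^sup>2 \<le> U (t + d) y * U (t - d) z"
        using U_midpoint[of "t + d" "t - d" y z] by simp
      then have "ln ((U t ((y + z) /\<^sub>R 2))\<^sup>2) \<le> ln (U (t + d) y * U (t - d) z)"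
        using U_pos[of t "(y + z) /\<^sub>R 2"] by (intro ln_mono) auto
      then have "2 * ln (U t ((y + z) /\<^sub>R 2)) \<le> ln (U (t + d) y) + ln (U (t - d) z)"
        using U_pos[of t "(y + z) /\<^sub>R 2"] U_pos[of "t + d" y] U_pos[of "t - d" z] by (simp add: ln_realpow ln_mult)
      then have "eps * (2 * ln (U t ((y + z) /\<^sub>R 2))) \<le> eps * (ln (U (t + d) y) + ln (U (t - d) z))"
        using eps by (intro mult_left_mono) auto
      then have "r (t + d) y * r (t - d) z \<le> (r t ((y + z) /\<^sub>R 2))\<^sup>2"
        unfolding r_def power2_eq_square exp_add[symmetric] by (simp add: algebra_simps)
      then show ?thesis using True mid
        by (simp add: ennreal_mult[symmetric] ennreal_power r_def)
    qed auto
  qed measurable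
  then have "ennreal (L (t + d) * L (t - d)) \<le> ennreal ((L t)\<^sup>2)"
    using L_nonneg by (simp add: ennreal_mult ennreal_power)
  then show ?thesis by (simp add: L_nonneg)
qed

text \<open>In units of \<open>pi^2 * d\<close>, the 6 is made of 4 from \<open>G_comparable\<close>
  and 2 from the term \<open>(norm z)^2 / 2\<close>.\<close>

lemma r_comparable:
  assumes "y \<in> cube" "z \<in> cube"
  shows "r t y \<le> exp (6 * pi\<^sup>2 * real CARD('d)) * r t z"
proof -
  define c where "c = pi\<^sup>2 * real CARD('d)"
  have "(norm z)\<^sup>2 \<le> 4 * c"
    using norm_diff_cube[OF assms(2) zero_in_cube] by (simp add: c_def)
  moreover have "eps * ln (G t z) \<le> eps * ln (G t y) + 4 * c"
    using G_comparable[OF assms(2,1), of t] by (simp add: c_def)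
  ultimately have "eps * ln (U t z) \<le> 6 * c + eps * ln (U t y)"
    unfolding eps_ln_U using zero_le_power2[of "norm y"] by linarith
  then have "- eps * ln (U t y) \<le> 6 * pi\<^sup>2 * real CARD('d) + - eps * ln (U t z)"
    by (simp add: c_def)
  then show ?thesis by (simp add: r_def flip: exp_add)
qed

section \<open>Variance and dual gap in terms of the tilted family\<close>

text \<open>The first marginal of the plan is \<open>mu\<close>: Fubini, then
  \<open>k_marginal_y\<close> in the inner integral.\<close>

lemma integral_against_plan:
  assumes [measurable]: "f \<in> borel_measurable borel" and f: "\<And>x. \<bar>f x\<bar> \<le> C"
  shows "(\<integral>y. (\<integral>x. f x * (k x y * mu x) \<partial>torus) * nu y \<partial>torus) = (\<integral>x. f x * mu x \<partial>torus)"
proof -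
  interpret P: finite_measure "torus \<Otimes>\<^sub>M torus :: ((real^'d) \<times> (real^'d)) measure"
    by (rule finite_measure_pair_measure) (rule finite_measure_torus)+
  obtain B where B: "\<And>x y. k x y \<le> B" by (rule k_bounded) (rule that)
  have int: "integrable (torus \<Otimes>\<^sub>M torus) (\<lambda>(x, y). f x * (k x y * mu x) * nu y)"
  proof (rule P.integrable_const_bound[where B="C * (B * Mmu) * Mnu"])
    show "AE p in torus \<Otimes>\<^sub>M torus. norm (case p of (x, y) \<Rightarrow> f x * (k x y * mu x) * nu y) \<le> C * (B * Mmu) * Mnu"
    proof (rule AE_I2, clarify)
      fix x y
      have "0 \<le> C" using f[of x] by linarith
      then have "\<bar>f x\<bar> * (k x y * mu x) * nu y \<le> C * (B * Mmu) * Mnu"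
        using f[of x] B[of x y] k_pos[of x y] mu_bounds[of x] nu_bounds[of y]
        by (intro mult_mono) auto
      then show "norm (f x * (k x y * mu x) * nu y) \<le> C * (B * Mmu) * Mnu"
        using k_pos[of x y] mu_bounds[of x] nu_bounds[of y] by (simp add: abs_mult)
    qed
  qed (unfold k_def, measurable)
  have "(\<integral>y. (\<integral>x. f x * (k x y * mu x) \<partial>torus) * nu y \<partial>torus) = (\<integral>y. (\<integral>x. f x * (k x y * mu x) * nu y \<partial>torus) \<partial>torus)"
    by (simp only: integral_mult_left_zero)
  also have "\<dots> = (\<integral>x. (\<integral>y. f x * (k x y * mu x) * nu y \<partial>torus) \<partial>torus)"
    by (rule torus_pair.Fubini_integral[OF int])
  also have "\<dots> = (\<integral>x. f x * mu x * (\<integral>y. k x y * nu y \<partial>torus) \<partial>torus)"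
    by (simp add: ac_simps flip: integral_mult_right_zero)
  finally show ?thesis by (simp add: k_marginal_y)
qed

text \<open>Variance ignores the shift by \<open>inf chi\<close> and scales quadratically under
  division by \<open>eps\<close>.\<close>

lemma tvar_eq: "tvar mu chi = eps\<^sup>2 * ((\<integral>x. (X x)\<^sup>2 * mu x \<partial>torus) - (\<integral>x. X x * mu x \<partial>torus)\<^sup>2)"
proof -
  define b where "b = (INF z. chi z)"
  let ?e = "\<integral>x. X x * mu x \<partial>torus"
  have chi_X: "chi x = eps * X x + b" for x using eps by (simp add: X_def b_def)
  have i1: "integrable torus (\<lambda>x. X x * mu x)"
    by (rule bounded_density_integrable[OF mu, where B=s]) (use X_bounds in auto)
  have i2: "integrable torus (\<lambda>x. (X x)\<^sup>2 * mu x)"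
    by (rule bounded_density_integrable[OF mu, where B="s\<^sup>2"]) (use X_bounds in \<open>auto intro!: power_mono\<close>)
  have i0: "integrable torus mu"
    using bounded_density_integrable[OF mu, of "\<lambda>_. 1" 1] by simp
  have "tint (\<lambda>y. chi y * mu y) = (\<integral>x. eps * (X x * mu x) + b * mu x \<partial>torus)"
    unfolding tint_torus by (rule Bochner_Integration.integral_cong) (simp_all add: chi_X algebra_simps)
  also have "\<dots> = eps * ?e + b" using i0 i1 by (simp add: mu_int)
  finally have mean: "tint (\<lambda>y. chi y * mu y) = eps * ?e + b" .
  have "tvar mu chi = (\<integral>x. eps\<^sup>2 * ((X x)\<^sup>2 * mu x - 2 * ?e * (X x * mu x) + ?e\<^sup>2 * mu x) \<partial>torus)"
    unfolding tvar_def mean unfolding tint_torus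
    by (rule Bochner_Integration.integral_cong) (simp_all add: chi_X power2_eq_square algebra_simps)
  also have "\<dots> = eps\<^sup>2 * ((\<integral>x. (X x)\<^sup>2 * mu x \<partial>torus) - 2 * ?e * ?e + ?e\<^sup>2)"
    using i0 i1 i2 by (simp add: mu_int)
  finally show ?thesis by (simp add: power2_eq_square)
qed

text \<open>The transform of \<open>phi + chi\<close> is \<open>psi - b - eps * Lam\<close>. The
  constant \<open>b\<close> cancels against the one gained in the integral over \<open>mu\<close>,
  since both densities have mass 1.\<close>

lemma gap_eq:
  "Idual eps mu nu phi - Idual eps mu nu (\<lambda>x. phi x + chi x) =
    eps * ((\<integral>y. log_mgf torus (\<lambda>x. k x y * mu x) X 1 * nu y \<partial>torus) - (\<integral>x. X x * mu x \<partial>torus))"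
proof -
  define b where "b = (INF z. chi z)"
  let ?Lam = "\<lambda>y. log_mgf torus (\<lambda>x. k x y * mu x) X 1"
  have chi_X: "chi x = eps * X x + b" for x using eps by (simp add: X_def b_def)
  obtain B where B: "\<And>x y. k x y \<le> B" by (rule k_bounded) (rule that)
  have T: "cT_mu eps mu (\<lambda>x. phi x + chi x) y = psi y - b - eps * ?Lam y" for y
  proof -
    have "tint (\<lambda>x. exp ((phi x + chi x - ecost eps x y) / eps) * mu x)
      = (\<integral>x. exp (b / eps) * (exp (phi x / eps + 1 * X x) * H (x - y) * mu x) \<partial>torus)"
      unfolding tint_torus exp_minus_ecost[OF eps]
      by (rule Bochner_Integration.integral_cong) (use eps in \<open>simp_all add: chi_X add_divide_distrib exp_add\<close>)
    also have "\<dots> = exp (b / eps) * G 1 y" unfolding G_def by (rule integral_mult_right_zero)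
    finally have "cT_mu eps mu (\<lambda>x. phi x + chi x) y = - eps * (b / eps + ln (G 1 y))"
      using G_pos[of 1 y] by (simp add: cT_mu_def ln_mult)
    then show ?thesis unfolding log_mgf_k using eps by (simp add: distrib_left)
  qed
  have Lam: "\<bar>?Lam y\<bar> \<le> s" for y
    using tilt.Lam_bound[OF tilt_k[OF B], of y 1] by simp
  have mLam: "?Lam \<in> borel_measurable borel"
    unfolding log_mgf_k by measurable
  have i1: "integrable torus (\<lambda>x. X x * mu x)"
    by (rule bounded_density_integrable[OF mu, where B=s]) (use X_bounds in auto)
  have i0: "integrable torus mu" "integrable torus nu"
    using bounded_density_integrable[OF mu, of "\<lambda>_. 1" 1] bounded_density_integrable[OF nu, of "\<lambda>_. 1" 1] by simp_all
  have iL: "integrable torus (\<lambda>y. ?Lam y * nu y)"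
    by (rule bounded_density_integrable[OF nu mLam Lam])
  obtain Bp where Bp: "\<And>x. \<bar>phi x\<bar> \<le> Bp" by (rule tcont_bounded[OF phi]) (rule that)
  obtain Bs where Bs: "\<And>x. \<bar>psi x\<bar> \<le> Bs" by (rule tcont_bounded[OF psi]) (rule that)
  have ip: "integrable torus (\<lambda>x. phi x * mu x)"
    by (rule bounded_density_integrable[OF mu tcont_measurable[OF phi] Bp])
  have iq: "integrable torus (\<lambda>x. psi x * nu x)"
    by (rule bounded_density_integrable[OF nu tcont_measurable[OF psi] Bs])
  have "tint (\<lambda>x. (phi x + chi x) * mu x) = (\<integral>x. phi x * mu x + (eps * (X x * mu x) + b * mu x) \<partial>torus)"
    unfolding tint_torus by (rule Bochner_Integration.integral_cong) (simp_all add: chi_X algebra_simps)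
  also have "\<dots> = tint (\<lambda>x. phi x * mu x) + (eps * (\<integral>x. X x * mu x \<partial>torus) + b)"
    unfolding tint_torus using ip i1 i0 by (simp add: mu_int)
  finally have 1: "tint (\<lambda>x. (phi x + chi x) * mu x) = tint (\<lambda>x. phi x * mu x) + (eps * (\<integral>x. X x * mu x \<partial>torus) + b)" .
  have "tint (\<lambda>y. cT_mu eps mu (\<lambda>x. phi x + chi x) y * nu y)
     = (\<integral>y. psi y * nu y - (b * nu y + eps * (?Lam y * nu y)) \<partial>torus)"
    unfolding tint_torus T by (rule Bochner_Integration.integral_cong) (simp_all add: algebra_simps)
  also have "\<dots> = tint (\<lambda>y. psi y * nu y) - (b + eps * (\<integral>y. ?Lam y * nu y \<partial>torus))"
    unfolding tint_torus using iq i0 iL by (simp add: nu_int)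
  finally show ?thesis
    unfolding Idual_def 1 psi_eq[symmetric] by (simp add: algebra_simps)
qed

text \<open>The abstract \<open>variance_bound\<close> in the original scale: the variance carries
  \<open>eps^2\<close> and the gap \<open>eps\<close>, so its constant is multiplied by
  \<open>eps\<close>, and \<open>4 * s\<close> becomes \<open>4 * osc chi\<close>.\<close>

theorem variance_le:
  "0 \<le> Idual eps mu nu phi - Idual eps mu nu (\<lambda>x. phi x + chi x)"
  "tvar mu chi \<le> (2 * eps + 2 * (Mnu / mnu * exp (6 * pi\<^sup>2 * real CARD('d))) + 4 * osc chi) *
    (Idual eps mu nu phi - Idual eps mu nu (\<lambda>x. phi x + chi x))"
proof -
  let ?gap = "Idual eps mu nu phi - Idual eps mu nu (\<lambda>x. phi x + chi x)"
  let ?a = "\<lambda>y x. k x y * mu x" and ?K = "exp (6 * pi\<^sup>2 * real CARD('d))"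
  obtain B where B: "\<And>x y. k x y \<le> B" by (rule k_bounded) (rule that)
  obtain Bs where Bs: "\<And>x. \<bar>psi x\<bar> \<le> Bs" by (rule tcont_bounded[OF psi]) (rule that)
  \<comment> \<open>Both variables range over the torus. The weight is at most
    \<open>exp Bs\<close>, as the quadratic term only decreases it; \<open>K\<close> comes from
    \<open>r_comparable\<close>.\<close>
  interpret F: tilt_family torus torus ?a X nu "\<lambda>y. exp (psi y - (norm y)\<^sup>2 / 2)" s "B * Mmu" mnu Mnu "exp Bs" ?K eps
  proof (intro tilt_family.intro tilt_family_axioms.intro finite_measure_torus, goal_cases)
    case (1 y)
    show ?case by (rule tilt_k[OF B])
  next
    case 2
    show ?case unfolding k_def by measurable
  next
    case 3
    show ?case by (rule measurable_torus) measurable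
  next
    case 4
    show ?case by (rule measurable_torus) measurable
  next
    case (5 y)
    then show ?case using nu_bounds by blast
  next
    case 6
    show ?case by (rule nu)
  next
    case 7
    show ?case by (rule nu_int)
  next
    case 8
    show ?case by (rule measurable_torus) measurable
  next
    case (9 y)
    have "psi y - (norm y)\<^sup>2 / 2 \<le> Bs" using Bs[of y] zero_le_power2[of "norm y"] by linarith
    then show ?case by simp
  next
    case 10
    show ?case by (rule eps)
  next
    case (11 t d)
    show ?case using L_log_concave[of t d] unfolding weight_eq_r L_def .
  next
    case (12 t y y')
    then show ?case unfolding weight_eq_r using r_comparable[of y y' t] by simp
  qed
  have m0: "exp_moment torus (?a y) X 0 0 = 1" for y
    using tilt.mom_0_0[OF tilt_k[OF B]] .
  have "F.EP 0 = (\<integral>y. (\<integral>x. X x * (k x y * mu x) \<partial>torus) * nu y \<partial>torus)"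
    unfolding F.EP_def tilted_mean_def m0 unfolding exp_moment_def by simp
  also have "\<dots> = (\<integral>x. X x * mu x \<partial>torus)"
    by (rule integral_against_plan[where C=s]) (use X_bounds in auto)
  finally have EP: "F.EP 0 = (\<integral>x. X x * mu x \<partial>torus)" .
  have "(\<integral>y. tilted_square torus (?a y) X 0 * nu y \<partial>torus) = (\<integral>y. (\<integral>x. (X x)\<^sup>2 * (k x y * mu x) \<partial>torus) * nu y \<partial>torus)"
    unfolding tilted_square_def m0 unfolding exp_moment_def by simp
  also have "\<dots> = (\<integral>x. (X x)\<^sup>2 * mu x \<partial>torus)"
    by (rule integral_against_plan[where C="s\<^sup>2"]) (use X_bounds in \<open>auto intro!: power_mono\<close>)
  finally have EQ: "(\<integral>y. tilted_square torus (?a y) X 0 * nu y \<partial>torus) = (\<integral>x. (X x)\<^sup>2 * mu x \<partial>torus)" .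
  have gap: "?gap = eps * (F.EL 1 - F.EP 0)"
    unfolding gap_eq EP F.EL_def ..
  show "0 \<le> ?gap" unfolding gap using F.variance_bound(1) eps by simp
  have "tvar mu chi \<le> eps\<^sup>2 * ((2 + 2 * (Mnu / mnu * ?K / eps) + 4 * s) * (F.EL 1 - F.EP 0))"
    unfolding tvar_eq using F.variance_bound(2) unfolding EQ EP by (intro mult_left_mono) auto
  also have "\<dots> = (2 * eps + 2 * (Mnu / mnu * ?K) + 4 * osc chi) * ?gap"
    unfolding gap s_def using eps nu(2) by (simp add: field_simps power2_eq_square)
  finally show "tvar mu chi \<le> (2 * eps + 2 * (Mnu / mnu * ?K) + 4 * osc chi) * ?gap" .
qed

end

section \<open>The estimate with the stated constants\<close>

lemma schrodinger_variance_le: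
  fixes mu nu phi psi chi :: "real^'d \<Rightarrow> real"
  assumes "0 < eps" "0 < mmu" "0 < mnu" "bounded_density mu mmu Mmu" "bounded_density nu mnu Mnu"
    and "tcont phi" "tcont psi" "tcont chi" "phi = cT_mu eps nu psi" "psi = cT_mu eps mu phi"
    and "0 < alpha"
  shows "tvar mu chi \<le> (4 * eps + 2 * Mnu / mnu * exp (2 * R\<^sup>2 / alpha + 8 * pi\<^sup>2 * real CARD('d))
      + 8 * (osc chi)\<^sup>2 / (3 * eps)) * (Idual eps mu nu phi - Idual eps mu nu (\<lambda>x. phi x + chi x))"
proof -
  interpret schrodinger eps mu nu phi psi chi mmu Mmu mnu Mnu
    by standard (fact assms)+
  let ?o = "osc chi"
  \<comment> \<open>Completing the square replaces the linear dependence on the oscillation by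
    \<open>2 * eps\<close> plus a quadratic term; here \<open>2 <= 8 / 3\<close>.\<close>
  have "4 * ?o \<le> 2 * eps + 8 * ?o\<^sup>2 / (3 * eps)"
  proof -
    have "0 \<le> 2 * (eps - ?o)\<^sup>2 / eps" using assms(1) by simp
    also have "\<dots> = 2 * eps - 4 * ?o + 2 * ?o\<^sup>2 / eps"
      using assms(1) by (simp add: field_simps power2_eq_square)
    also have "2 * ?o\<^sup>2 / eps \<le> 8 * ?o\<^sup>2 / (3 * eps)"
      using assms(1) by (simp add: field_simps)
    finally show ?thesis by simp
  qed
  \<comment> \<open>The exponent grows, as \<open>6 <= 8\<close> and \<open>2 * R^2 / alpha\<close>
    is nonnegative.\<close>
  moreover have "2 * (Mnu / mnu * exp (6 * pi\<^sup>2 * real CARD('d)))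
      \<le> 2 * Mnu / mnu * exp (2 * R\<^sup>2 / alpha + 8 * pi\<^sup>2 * real CARD('d))"
  proof -
    have "0 \<le> Mnu / mnu" using nu_bounds[of 0] assms(3) by simp
    moreover have "0 \<le> 2 * R\<^sup>2 / alpha" using assms(11) by simp
    then have "6 * pi\<^sup>2 * real CARD('d) \<le> 2 * R\<^sup>2 / alpha + 8 * pi\<^sup>2 * real CARD('d)"
      by (simp add: add_increasing mult_right_mono)
    ultimately have "Mnu / mnu * exp (6 * pi\<^sup>2 * real CARD('d))
        \<le> Mnu / mnu * exp (2 * R\<^sup>2 / alpha + 8 * pi\<^sup>2 * real CARD('d))"
      by (intro mult_left_mono) auto
    then show ?thesis by simp
  qed
  ultimately show ?thesis
    by (intro order_trans[OF variance_le(2)] mult_right_mono variance_le(1)) linarith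
qed

theorem theorem3p1:
  shows "\<exists>Cnu Cmu :: real \<Rightarrow> real \<Rightarrow> real.
    (\<forall>m M. 0 < m \<longrightarrow> 0 < M \<longrightarrow> 0 < Cnu m M \<and> 0 < Cmu m M) \<and>
    (\<forall>(alpha::real) (R::real) (mu :: real^'d \<Rightarrow> real) nu mmu Mmu mnu Mnu (eps::real) phi psi.
       0 < alpha \<and> 0 < R \<and> strongly_convex_T alpha (tball 0 R) (\<lambda>x::real^'d. (tdist 0 x)\<^sup>2) \<and>
       0 < mmu \<and> 0 < Mmu \<and> 0 < mnu \<and> 0 < Mnu \<and>
       bounded_density mu mmu Mmu \<and> bounded_density nu mnu Mnu \<and>
       0 < eps \<and> schrodinger_potentials eps mu nu phi psi \<longrightarrow>
       (\<forall>chi. tcont chi \<longrightarrow>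
          tvar mu chi \<le> (4 * eps + Cnu mnu Mnu * exp (2 * R\<^sup>2 / alpha + 8 * pi\<^sup>2 * real CARD('d))
                          + 8 * (osc chi)\<^sup>2 / (3 * eps)) *
                        (Idual eps mu nu phi - Idual eps mu nu (\<lambda>x. phi x + chi x))) \<and>
       (\<forall>eta. tcont eta \<longrightarrow>
          tvar nu eta \<le> (4 * eps + Cmu mmu Mmu * exp (2 * R\<^sup>2 / alpha + 8 * pi\<^sup>2 * real CARD('d))
                          + 8 * (osc eta)\<^sup>2 / (3 * eps)) *
                        (Idualbar eps mu nu psi - Idualbar eps mu nu (\<lambda>y. psi y + eta y))))"
\<comment> \<open>The ratio \<open>M / m\<close> is the cost of passing between the log-concave
  weight and the density; the 2 comes from integrating twice in \<open>t\<close>.\<close>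
proof (intro exI[of _ "\<lambda>m M. 2 * M / m"] conjI allI impI)
  show "0 < 2 * M / m" if "0 < m" "0 < M" for m M :: real using that by simp
  show "0 < 2 * M / m" if "0 < m" "0 < M" for m M :: real using that by simp
next
  fix alpha R :: real and mu nu :: "real^'d \<Rightarrow> real" and mmu Mmu mnu Mnu eps phi psi
  assume A: "0 < alpha \<and> 0 < R \<and> strongly_convex_T alpha (tball 0 R) (\<lambda>x::real^'d. (tdist 0 x)\<^sup>2) \<and>
       0 < mmu \<and> 0 < Mmu \<and> 0 < mnu \<and> 0 < Mnu \<and>
       bounded_density mu mmu Mmu \<and> bounded_density nu mnu Mnu \<and>
       0 < eps \<and> schrodinger_potentials eps mu nu phi psi"
  then have pot: "tcont phi" "tcont psi" "phi = cT_mu eps nu psi" "psi = cT_mu eps mu phi"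
    unfolding schrodinger_potentials_def cT_nu_eq_cT_mu by blast+
  from A have eps: "0 < eps" and mmu: "0 < mmu" and mnu: "0 < mnu" and alpha: "0 < alpha"
    and dens: "bounded_density mu mmu Mmu" "bounded_density nu mnu Mnu" by blast+
  fix chi :: "real^'d \<Rightarrow> real" assume chi: "tcont chi"
  show "tvar mu chi \<le> (4 * eps + 2 * Mnu / mnu * exp (2 * R\<^sup>2 / alpha + 8 * pi\<^sup>2 * real CARD('d))
      + 8 * (osc chi)\<^sup>2 / (3 * eps)) * (Idual eps mu nu phi - Idual eps mu nu (\<lambda>x. phi x + chi x))"
    by (rule schrodinger_variance_le[OF eps mmu mnu dens pot(1,2) chi pot(3,4) alpha])
  \<comment> \<open>By symmetry of the cost the second functional is the first one with the
    marginals exchanged, so the second inequality is another instance of the first.\<close>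
  have "Idualbar eps mu nu g = Idual eps nu mu g" for g
    unfolding Idualbar_def Idual_def cT_nu_eq_cT_mu by simp
  then show "tvar nu chi \<le> (4 * eps + 2 * Mmu / mmu * exp (2 * R\<^sup>2 / alpha + 8 * pi\<^sup>2 * real CARD('d))
      + 8 * (osc chi)\<^sup>2 / (3 * eps)) * (Idualbar eps mu nu psi - Idualbar eps mu nu (\<lambda>x. psi x + chi x))"
    using schrodinger_variance_le[OF eps mnu mmu dens(2,1) pot(2,1) chi pot(4,3) alpha] by (simp only:)
qed

end
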